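(* Let $n\ge1$, $\alpha^2,\nu,t_0,\delta_M>0$, $\boldsymbol\beta\in\mathbb{R}^n$, $0<p<\infty$, and let $f\in L^2(\mathbb{R}^n)$ with $\|f\|_{H^p(\mathbb{R}^n)}<\infty$. Let $u$, with $u(\cdot,t)\in L^2(\mathbb{R}^n)$, solve $$u_t=\alpha^2\Delta u-\boldsymbol\beta\cdot\nabla u-\nu u+f(\mathbf{x}),\quad \mathbf{x}\in\mathbb{R}^n,\ t>0,\qquad u(\mathbf{x},0)=0,$$ and let $y=u(\cdot,t_0)$. For noisy data $y_\delta\in L^2(\mathbb{R}^n)$ with $\|y-y_\delta\|_{L^2(\mathbb{R}^n)}\le\delta$, $0<\delta\le\delta_M$, and $\mu>0$, let $f_{\delta,\mu}$ be the regularized solution, i.e. the inverse Fourier transform of $$\hat f_{\delta,\mu}(\boldsymbol\xi)=\frac{\Lambda(\boldsymbol\xi)}{1+\mu^2\|\boldsymbol\xi\|^2}\,\hat y_\delta(\boldsymbol\xi),\qquad \Lambda(\boldsymbol\xi)=\frac{z(\boldsymbol\xi)}{1-e^{-z(\boldsymbol\xi)t_0}},\qquad z(\boldsymbol\xi)=\alpha^2\|\boldsymbol\xi\|^2+i\,\boldsymbol\beta\cdot\boldsymbol\xi+\nu .$$ Then there exists a constant $K$ independent of $\delta$ (and of $y_\delta$) such that, for every $0<\delta\le\delta_M$ and every such $y_\delta$, choosing $\mu>0$ with $\mu^2=\delta^{\frac{2}{p+2}}$ gives $$\|f-f_{\delta,\mu}\|_{L^2(\mathbb{R}^n)}\le K\max\left\{\delta^{\frac{2}{p+2}},\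 \delta^{\frac{p}{p+2}}\right\}.$$
   Context: The Fourier transform is $\hat g(\boldsymbol\xi)=(2\pi)^{-n/2}\int_{\mathbb{R}^n}e^{-i\boldsymbol\xi\cdot\mathbf{x}}g(\mathbf{x})\,d\mathbf{x}$, extended to a unitary operator on $L^2(\mathbb{R}^n)$. The Sobolev norm is $\|f\|_{H^p(\mathbb{R}^n)}=\left(\int_{\mathbb{R}^n}|\hat f(\boldsymbol\xi)|^2(1+\|\boldsymbol\xi\|^2)^p\,d\boldsymbol\xi\right)^{1/2}$, with $\|\boldsymbol\xi\|$ the Euclidean norm. The evolution equation is understood in frequency space: $\hat u_t(\boldsymbol\xi,t)=-z(\boldsymbol\xi)\hat u(\boldsymbol\xi,t)+\hat f(\boldsymbol\xi)$, $\hat u(\boldsymbol\xi,0)=0$, so that $\hat u(\boldsymbol\xi,t)=\frac{1-e^{-z(\boldsymbol\xi)t}}{z(\boldsymbol\xi)}\hat f(\boldsymbol\xi)$, and for $y=u(\cdot,t_0)$ one has $\hat f=\Lambda\hat y$. The number $\delta_M>0$ is a fixed maximal noise level. *)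

theory Defs
  imports "HOL-Analysis.Analysis"
begin

definition ennreal_sqrt :: "ennreal \<Rightarrow> ennreal" where
  "ennreal_sqrt a = (if a = \<infinity> then \<infinity> else ennreal (sqrt (enn2real a)))"

text \<open>Norms take values in \<^typ>\<open>ennreal\<close>, so that they are \<open>\<infinity>\<close>, rather than an arbitrary
  default value, when the integral diverges.\<close>

definition L2_norm :: "(real ^ 'n \<Rightarrow> complex) \<Rightarrow> ennreal" where
  "L2_norm g = ennreal_sqrt (\<integral>\<^sup>+x. ennreal ((cmod (g x))\<^sup>2) \<partial>lebesgue)"

definition L2 :: "(real ^ 'n \<Rightarrow> complex) set" where
  "L2 = {g. g \<in> borel_measurable lebesgue \<and> L2_norm g < \<infinity>}"

definition L1 :: "(real ^ 'n \<Rightarrow> complex) set" where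
  "L1 = {g. integrable lebesgue g}"

definition fourier_integral :: "(real ^ 'n \<Rightarrow> complex) \<Rightarrow> real ^ 'n \<Rightarrow> complex" where
  "fourier_integral g \<xi> =
     complex_of_real ((2 * pi) powr (- real CARD('n) / 2)) *
     (\<integral>x. exp (- \<i> * complex_of_real (\<xi> \<bullet> x)) * g x \<partial>lebesgue)"

text \<open>The graph of the extension to \<^term>\<open>L2\<close>: the closure, in the product of the \<^term>\<open>L2\<close>
  norms, of the graph of \<^term>\<open>fourier_integral\<close> on \<^term>\<open>L1 \<inter> L2\<close>.\<close>

definition has_fourier :: "(real ^ 'n \<Rightarrow> complex) \<Rightarrow> (real ^ 'n \<Rightarrow> complex) \<Rightarrow> bool" where
  "has_fourier g G \<longleftrightarrow> g \<in> L2 \<and> G \<in> L2 \<and>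
     (\<exists>h :: nat \<Rightarrow> real ^ 'n \<Rightarrow> complex.
        (\<forall>k. h k \<in> L1 \<inter> L2) \<and>
        (\<lambda>k. L2_norm (\<lambda>x. h k x - g x)) \<longlonglongrightarrow> 0 \<and>
        (\<lambda>k. L2_norm (\<lambda>\<xi>. fourier_integral (h k) \<xi> - G \<xi>)) \<longlonglongrightarrow> 0)"

text \<open>Both operators are determined only up to null sets; the choice operator picks a
  representative.\<close>

definition fourier :: "(real ^ 'n \<Rightarrow> complex) \<Rightarrow> real ^ 'n \<Rightarrow> complex" where
  "fourier g = (SOME G. has_fourier g G)"

definition inverse_fourier :: "(real ^ 'n \<Rightarrow> complex) \<Rightarrow> real ^ 'n \<Rightarrow> complex" where
  "inverse_fourier G = (SOME g. has_fourier g G)"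

definition sobolev_norm :: "real \<Rightarrow> (real ^ 'n \<Rightarrow> complex) \<Rightarrow> ennreal" where
  "sobolev_norm p g = ennreal_sqrt
     (\<integral>\<^sup>+\<xi>. ennreal ((cmod (fourier g \<xi>))\<^sup>2 * (1 + (norm \<xi>)\<^sup>2) powr p) \<partial>lebesgue)"

definition symbol_z :: "real \<Rightarrow> real ^ 'n \<Rightarrow> real \<Rightarrow> real ^ 'n \<Rightarrow> complex" where
  "symbol_z \<alpha> \<beta> \<nu> \<xi> =
     complex_of_real (\<alpha>\<^sup>2 * (norm \<xi>)\<^sup>2) + \<i> * complex_of_real (\<beta> \<bullet> \<xi>) + complex_of_real \<nu>"

definition symbol_Lambda :: "real \<Rightarrow> real ^ 'n \<Rightarrow> real \<Rightarrow> real \<Rightarrow> real ^ 'n \<Rightarrow> complex" where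
  "symbol_Lambda \<alpha> \<beta> \<nu> t\<^sub>0 \<xi> =
     symbol_z \<alpha> \<beta> \<nu> \<xi> / (1 - exp (- symbol_z \<alpha> \<beta> \<nu> \<xi> * complex_of_real t\<^sub>0))"

text \<open>The problem \<open>u\<^sub>t = \<alpha>\<^sup>2 \<Delta>u - \<beta> \<bullet> \<nabla>u - \<nu> u + f\<close>, \<open>u(\<cdot>, 0) = 0\<close>, read in frequency space.
  The transform of each \<open>u t\<close> is determined only up to a null set depending on \<open>t\<close>, so the
  equation is required of a family \<open>U\<close> of representatives that is, for almost every
  frequency, continuous up to \<open>t = 0\<close> and differentiable for \<open>t > 0\<close>.\<close>

definition solves_evolution ::
  "real \<Rightarrow> real ^ 'n \<Rightarrow> real \<Rightarrow> (real ^ 'n \<Rightarrow> complex) \<Rightarrow> (real \<Rightarrow> real ^ 'n \<Rightarrow> complex) \<Rightarrow> bool"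
  where
  "solves_evolution \<alpha> \<beta> \<nu> f u \<longleftrightarrow>
     (\<exists>U :: real ^ 'n \<Rightarrow> real \<Rightarrow> complex.
        (\<forall>t\<ge>0. AE \<xi> in lebesgue. U \<xi> t = fourier (u t) \<xi>) \<and>
        (AE \<xi> in lebesgue.
           continuous_on {0..} (U \<xi>) \<and> U \<xi> 0 = 0 \<and>
           (\<forall>t>0. (U \<xi> has_vector_derivative
                     (- symbol_z \<alpha> \<beta> \<nu> \<xi> * U \<xi> t + fourier f \<xi>)) (at t))))"

definition regularized_solution ::
  "real \<Rightarrow> real ^ 'n \<Rightarrow> real \<Rightarrow> real \<Rightarrow> real \<Rightarrow> (real ^ 'n \<Rightarrow> complex) \<Rightarrow> real ^ 'n \<Rightarrow> complex"
  where
  "regularized_solution \<alpha> \<beta> \<nu> t\<^sub>0 \<mu> y\<^sub>\<delta> =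
     inverse_fourier (\<lambda>\<xi>. symbol_Lambda \<alpha> \<beta> \<nu> t\<^sub>0 \<xi> /
       complex_of_real (1 + \<mu>\<^sup>2 * (norm \<xi>)\<^sup>2) * fourier y\<^sub>\<delta> \<xi>)"

end

theory Submission
  imports Defs "HOL-Probability.Characteristic_Functions"
begin

text \<open>
  \<^bold>\<open>Why the estimate holds.\<close> In frequency space every operator in sight is a multiplication.
  For almost every \<open>\<xi>\<close> the evolution equation is a scalar linear ODE, and its solution at
  time \<open>t\<^sub>0\<close> says that the transform of \<open>f\<close> is \<open>\<Lambda>\<close> times the transform of \<open>y\<close>
  (lemma \<open>AE_symbol_Lambda_data\<close>). Write \<open>F\<close>, \<open>Y\<close>, \<open>Y\<^sub>\<delta>\<close> for the transforms of \<open>f\<close>,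
  \<open>y\<close>, \<open>y\<^sub>\<delta>\<close>, let \<open>q = \<mu>\<^sup>2\<close>, \<open>r = \<parallel>\<xi>\<parallel>\<^sup>2\<close> and let \<open>m = \<Lambda> / (1 + q r)\<close> be the
  regularizing multiplier. The error splits into a bias and an amplified noise,
  \<open>F - m Y\<^sub>\<delta> = (q r / (1 + q r)) F + m (Y - Y\<^sub>\<delta>)\<close>.

  The bias factor is at most \<open>max q (q powr (p/2)) * (1 + r) powr (p/2)\<close>
  (lemma \<open>filter_bias_le\<close>), so the first term is controlled by the Sobolev norm of \<open>f\<close>.
  As \<open>Re z \<ge> \<nu> > 0\<close>, the denominator of \<open>\<Lambda>\<close> stays away from zero, and \<open>\<Lambda>\<close> grows at most
  like \<open>1 + r\<close> (lemma \<open>norm_symbol_Lambda_le\<close>); hence \<open>m\<close> is bounded by a constant times \<open>1/q\<close>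
  as long as \<open>q\<close> stays bounded, which is what \<open>\<delta> \<le> \<delta>\<^sub>M\<close> provides, and the second term
  is at most a constant times \<open>\<delta>/q\<close>. The choice \<open>q = \<delta> powr (2/(p+2))\<close> balances the two:
  \<open>q powr (p/2)\<close> and \<open>\<delta>/q\<close> are both \<open>\<delta> powr (p/(p+2))\<close>.

  \<^bold>\<open>Why frequency space suffices.\<close> Both the data error and the reconstruction error are measured
  in \<open>x\<close>-space, so Plancherel's theorem is needed in full: the closure \<open>has_fourier\<close> of the
  Fourier integral on \<open>L1 \<inter> L2\<close> is isometric, defined on all of \<open>L2\<close> and onto. Surjectivity
  matters because \<open>inverse_fourier G\<close> is a chosen preimage of \<open>G\<close> and means nothing unless a
  preimage exists.

  All three properties come from the Gaussian means
  \<open>gauss_mean s g x = \<integral> gauss w * g (x + s w) dw\<close>. They converge to \<open>g\<close> in \<open>L2\<close> as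
  \<open>s\<close> tends to 0 (lemma \<open>gauss_mean_tendsto_L2\<close>), because translation is continuous in \<open>L2\<close>; and
  for \<open>g \<in> L1\<close> they are the inversion integral of the transform of \<open>g\<close> damped by a Gaussian
  (lemma \<open>gauss_summed_inversion\<close>), because the Gaussian is its own Fourier transform. Testing the
  second fact against \<open>g\<close> shows that the Gaussian-damped square integral of the transform is
  \<open>\<langle>g, gauss_mean s g\<rangle>\<close>, and \<open>s \<rightarrow> 0\<close> gives the isometry on \<open>L1 \<inter> L2\<close>. The same
  fact read backwards says that the inverse transform of \<open>G\<close>, damped by a Gaussian, has
  transform \<open>gauss_mean s G\<close>, which tends to \<open>G\<close>; so \<open>L1 \<inter> L2\<close> lies in the range.
  Truncation and completeness of \<open>L2\<close> extend both statements to \<open>L2\<close>.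
\<close>

section \<open>The space L2: Minkowski inequality and completeness\<close>

lemma ennreal_sqrt_square [simp]: "(ennreal_sqrt a)\<^sup>2 = a"
  by (cases a) (auto simp: ennreal_sqrt_def power2_eq_square ennreal_top_mult ennreal_mult[symmetric])

lemma ennreal_sqrt_power2 [simp]: "ennreal_sqrt (a\<^sup>2) = a"
  by (cases a) (auto simp: ennreal_sqrt_def ennreal_power power2_eq_square ennreal_top_mult ennreal_mult[symmetric])

lemma ennreal_sqrt_mono: "a \<le> b \<Longrightarrow> ennreal_sqrt a \<le> ennreal_sqrt b"
  by (cases a; cases b) (auto simp: ennreal_sqrt_def top_unique)

lemma ennreal_power2_le_iff: "a\<^sup>2 \<le> b\<^sup>2 \<longleftrightarrow> a \<le> (b :: ennreal)"
  using ennreal_sqrt_mono[of "a\<^sup>2" "b\<^sup>2"] power_mono_ennreal[of a b 2] by auto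

lemma ennreal_sqrt_less_top_iff: "ennreal_sqrt a < \<infinity> \<longleftrightarrow> a < \<infinity>"
  by (cases a) (auto simp: ennreal_sqrt_def)

lemma tendsto_ennreal_sqrt_0:
  assumes "(a \<longlongrightarrow> 0) F"
  shows "((\<lambda>k. ennreal_sqrt (a k)) \<longlongrightarrow> 0) F"
proof (rule order_tendstoI)
  fix b :: ennreal assume "0 < b"
  then have "0 < b\<^sup>2" by (auto simp: power2_eq_square zero_less_iff_neq_zero)
  then have "eventually (\<lambda>k. a k < b\<^sup>2) F" using assms by (auto dest: order_tendstoD)
  then show "eventually (\<lambda>k. ennreal_sqrt (a k) < b) F"
    by eventually_elim (metis ennreal_sqrt_square ennreal_power2_le_iff not_le)
qed auto

text \<open>A nonnegative integral does not change under completion of the measure, for any integrand. So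
  \<open>L2_norm\<close> can be computed with \<open>lborel\<close>, which is what Tonelli's theorem and
  substitutions need, while membership in \<open>L2\<close> refers to \<open>lebesgue\<close>.\<close>

lemma L2_norm_power2: "(L2_norm g)\<^sup>2 = (\<integral>\<^sup>+x. ennreal ((cmod (g x))\<^sup>2) \<partial>lborel)"
  by (simp add: L2_norm_def nn_integral_completion)

lemma L2_norm_tendsto_0I:
  assumes "((\<lambda>k. \<integral>\<^sup>+x. ennreal ((cmod (g k x))\<^sup>2) \<partial>lborel) \<longlongrightarrow> 0) F"
  shows "((\<lambda>k. L2_norm (g k)) \<longlongrightarrow> 0) F"
  using tendsto_ennreal_sqrt_0[OF assms] by (simp add: L2_norm_def nn_integral_completion)

lemma L2_norm_cong_AE:
  assumes "AE x in lebesgue. g x = h x"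
  shows "L2_norm g = L2_norm h"
  unfolding L2_norm_def using assms by (intro arg_cong[where f = ennreal_sqrt] nn_integral_cong_AE) auto

lemma L2_norm_mult_le:
  fixes g :: "real ^ 'n \<Rightarrow> complex"
  assumes [measurable]: "g \<in> borel_measurable lebesgue" and c: "c \<ge> 0"
    and bd: "AE x in lebesgue. cmod (h x) \<le> c * cmod (g x)"
  shows "L2_norm h \<le> ennreal c * L2_norm g"
proof -
  have "(L2_norm h)\<^sup>2 \<le> (\<integral>\<^sup>+x. ennreal (c\<^sup>2) * ennreal ((cmod (g x))\<^sup>2) \<partial>lebesgue)"
    unfolding L2_norm_def ennreal_sqrt_square
    using bd by (intro nn_integral_mono_AE, elim eventually_mono)
       (auto simp: ennreal_mult[symmetric] power_mult_distrib[symmetric] intro!: ennreal_leI power_mono)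
  also have "\<dots> = (ennreal c * L2_norm g)\<^sup>2"
    using c by (subst nn_integral_cmult) (auto simp: L2_norm_def ennreal_power power_mult_distrib)
  finally show ?thesis by (simp add: ennreal_power2_le_iff)
qed

text \<open>Minkowski's inequality: expand the square and use Cauchy--Schwarz on the cross term.\<close>

lemma L2_norm_add_le:
  fixes g h :: "real ^ 'n \<Rightarrow> complex"
  assumes [measurable]: "g \<in> borel_measurable lebesgue" "h \<in> borel_measurable lebesgue"
  shows "L2_norm (\<lambda>x. g x + h x) \<le> L2_norm g + L2_norm h"
proof -
  let ?I = "\<lambda>f. \<integral>\<^sup>+x. f x \<partial>lebesgue"
  let ?C = "?I (\<lambda>x. ennreal (cmod (g x)) * ennreal (cmod (h x)))"
  have "?C\<^sup>2 \<le> (L2_norm g * L2_norm h)\<^sup>2"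
    using Cauchy_Schwarz_nn_integral[of "\<lambda>x. ennreal (cmod (g x))" lebesgue "\<lambda>x. ennreal (cmod (h x))"]
    by (simp add: L2_norm_def ennreal_power power_mult_distrib)
  then have C: "?C \<le> L2_norm g * L2_norm h" by (simp only: ennreal_power2_le_iff)
  have "(L2_norm (\<lambda>x. g x + h x))\<^sup>2 \<le>
      ?I (\<lambda>x. ennreal ((cmod (g x))\<^sup>2) + (2 * (ennreal (cmod (g x)) * ennreal (cmod (h x))) + ennreal ((cmod (h x))\<^sup>2)))"
    unfolding L2_norm_def ennreal_sqrt_square
  proof (rule nn_integral_mono)
    fix x
    have "(cmod (g x + h x))\<^sup>2 \<le> (cmod (g x) + cmod (h x))\<^sup>2"
      by (intro power_mono norm_triangle_ineq) auto
    also have "\<dots> = (cmod (g x))\<^sup>2 + (2 * (cmod (g x) * cmod (h x)) + (cmod (h x))\<^sup>2)"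
      by (simp add: power2_sum)
    finally show "ennreal ((cmod (g x + h x))\<^sup>2) \<le> ennreal ((cmod (g x))\<^sup>2) +
       (2 * (ennreal (cmod (g x)) * ennreal (cmod (h x))) + ennreal ((cmod (h x))\<^sup>2))"
      by (subst ennreal_numeral[symmetric])
         (simp add: ennreal_mult[symmetric] ennreal_plus[symmetric] ennreal_leI del: ennreal_plus ennreal_numeral)
  qed
  also have "\<dots> = (L2_norm g)\<^sup>2 + (2 * ?C + (L2_norm h)\<^sup>2)"
    by (simp add: nn_integral_add nn_integral_cmult L2_norm_def)
  also have "\<dots> \<le> (L2_norm g)\<^sup>2 + (2 * (L2_norm g * L2_norm h) + (L2_norm h)\<^sup>2)"
    using C by (intro add_mono mult_left_mono) auto
  also have "\<dots> = (L2_norm g + L2_norm h)\<^sup>2"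
    by (simp add: power2_sum algebra_simps)
  finally show ?thesis by (simp only: ennreal_power2_le_iff)
qed

lemma L2_measurable [measurable_dest]: "g \<in> L2 \<Longrightarrow> g \<in> borel_measurable lebesgue"
  by (simp add: L2_def)

lemma L2_norm_uminus [simp]: "L2_norm (\<lambda>x. - g x) = L2_norm g"
  by (simp add: L2_norm_def)

lemma L2_norm_minus_commute: "L2_norm (\<lambda>x. g x - h x) = L2_norm (\<lambda>x. h x - g x)"
  by (simp add: L2_norm_def norm_minus_commute)

lemma L2_norm_diff_le:
  fixes g h :: "real ^ 'n \<Rightarrow> complex"
  assumes [measurable]: "g \<in> borel_measurable lebesgue" "h \<in> borel_measurable lebesgue"
  shows "L2_norm (\<lambda>x. g x - h x) \<le> L2_norm g + L2_norm h"
  using L2_norm_add_le[of g "\<lambda>x. - h x"] by simp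

lemma L2_norm_triangle:
  fixes g h k :: "real ^ 'n \<Rightarrow> complex"
  assumes [measurable]: "g \<in> borel_measurable lebesgue" "h \<in> borel_measurable lebesgue" "k \<in> borel_measurable lebesgue"
  shows "L2_norm (\<lambda>x. g x - k x) \<le> L2_norm (\<lambda>x. g x - h x) + L2_norm (\<lambda>x. h x - k x)"
  using L2_norm_add_le[of "\<lambda>x. g x - h x" "\<lambda>x. h x - k x"] by simp

lemma L2_diff: "g \<in> L2 \<Longrightarrow> h \<in> L2 \<Longrightarrow> (\<lambda>x. g x - h x) \<in> L2"
  using L2_norm_diff_le[of g h] by (auto simp: L2_def intro: le_less_trans)

lemma L2_mult_bounded:
  fixes g m :: "real ^ 'n \<Rightarrow> complex"
  assumes "g \<in> L2" "m \<in> borel_measurable lebesgue" "\<And>x. cmod (m x) \<le> c" "c \<ge> 0"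
  shows "(\<lambda>x. m x * g x) \<in> L2"
proof -
  have "L2_norm (\<lambda>x. m x * g x) \<le> ennreal c * L2_norm g"
    using assms by (intro L2_norm_mult_le) (auto simp: norm_mult L2_def intro!: mult_right_mono)
  also have "\<dots> < \<infinity>" using assms by (auto simp: L2_def ennreal_mult_less_top)
  finally show ?thesis using assms by (auto simp: L2_def)
qed

text \<open>Not a global \<open>measurable\<close> rule: it would let the measurability prover factor every map
  through \<open>lebesgue\<close>.\<close>

lemma borel_measurable_lebesgue_ident: "(\<lambda>x. x) \<in> borel_measurable lebesgue"
  using id_borel_measurable_lebesgue by (simp add: id_def)

text \<open>Multipliers bounded by 1 that converge to 1. The lemma serves for truncation, where \<open>m\<close> is an
  indicator, and for the Gaussian cut-off in the proof of surjectivity.\<close>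

lemma L2_norm_tendsto_0_dominated:
  fixes g :: "real ^ 'n \<Rightarrow> complex"
  assumes g: "g \<in> L2"
    and m [measurable]: "\<And>k. m k \<in> borel_measurable lebesgue"
    and bd: "\<And>k x. cmod (m k x) \<le> 1"
    and lim: "\<And>x. (\<lambda>k. m k x) \<longlonglongrightarrow> 1"
  shows "(\<lambda>k. L2_norm (\<lambda>x. m k x * g x - g x)) \<longlonglongrightarrow> 0"
proof -
  note [measurable] = L2_measurable[OF g]
  have "(\<lambda>k. \<integral>\<^sup>+x. ennreal ((cmod (m k x * g x - g x))\<^sup>2) \<partial>lebesgue) \<longlonglongrightarrow> (\<integral>\<^sup>+x. 0 \<partial>(lebesgue :: (real^'n) measure))"
  proof (rule nn_integral_dominated_convergence)
    show "(\<integral>\<^sup>+x. ennreal 4 * ennreal ((cmod (g x))\<^sup>2) \<partial>lebesgue) < \<infinity>"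
      using g by (subst nn_integral_cmult)
         (auto simp: L2_def L2_norm_def ennreal_sqrt_less_top_iff[unfolded infinity_ennreal_def] ennreal_mult_less_top)
    have "cmod (m k x * g x - g x) \<le> 2 * cmod (g x)" for k x
    proof -
      have "cmod (m k x * g x - g x) \<le> cmod (m k x) * cmod (g x) + cmod (g x)"
        by (metis norm_mult norm_triangle_ineq4)
      also have "\<dots> \<le> 1 * cmod (g x) + cmod (g x)"
        by (intro add_right_mono mult_right_mono bd) auto
      finally show ?thesis by simp
    qed
    then have "(cmod (m k x * g x - g x))\<^sup>2 \<le> 4 * (cmod (g x))\<^sup>2" for k x
      using power_mono[of "cmod (m k x * g x - g x)" "2 * cmod (g x)" 2] by (simp add: power_mult_distrib)
    then show "AE x in lebesgue. ennreal ((cmod (m k x * g x - g x))\<^sup>2) \<le> ennreal 4 * ennreal ((cmod (g x))\<^sup>2)" for k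
      by (intro always_eventually allI, subst ennreal_mult[symmetric]) (auto intro!: ennreal_leI)
    have "(\<lambda>k. (cmod (m k x * g x - g x))\<^sup>2) \<longlonglongrightarrow> (cmod (1 * g x - g x))\<^sup>2" for x
      by (intro tendsto_intros lim)
    then have "(\<lambda>k. ennreal ((cmod (m k x * g x - g x))\<^sup>2)) \<longlonglongrightarrow> ennreal 0" for x
      by (intro tendsto_ennrealI) simp
    then show "AE x in lebesgue. (\<lambda>k. ennreal ((cmod (m k x * g x - g x))\<^sup>2)) \<longlonglongrightarrow> 0" by simp
  qed measurable
  then show ?thesis by (intro L2_norm_tendsto_0I) (simp add: nn_integral_completion)
qed

definition truncate :: "nat \<Rightarrow> (real ^ 'n \<Rightarrow> complex) \<Rightarrow> real ^ 'n \<Rightarrow> complex" where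
  "truncate k g x = (if norm x \<le> real k \<and> cmod (g x) \<le> real k then 1 else 0) * g x"

lemma truncate_L1_L2:
  fixes g :: "real ^ 'n \<Rightarrow> complex"
  assumes g: "g \<in> L2"
  shows "truncate k g \<in> L1 \<inter> L2"
proof -
  note [measurable] = L2_measurable[OF g] borel_measurable_lebesgue_ident
  have [measurable]: "truncate k g \<in> borel_measurable lebesgue"
    unfolding truncate_def by measurable
  have "integrable lebesgue (\<lambda>x::real^'n. real k * indicator (cball 0 (real k)) x)"
    by (intro integrable_mult_right integrable_real_indicator)
       (auto simp: emeasure_lborel_cball_finite[unfolded infinity_ennreal_def])
  then have "integrable lebesgue (truncate k g)"
    by (rule Bochner_Integration.integrable_bound) (auto simp: truncate_def)
  moreover have "truncate k g \<in> L2"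
    unfolding truncate_def[abs_def] by (rule L2_mult_bounded[OF g, where c = 1]) auto
  ultimately show ?thesis by (auto simp: L1_def)
qed

lemma truncate_tendsto:
  fixes g :: "real ^ 'n \<Rightarrow> complex"
  assumes g: "g \<in> L2"
  shows "(\<lambda>k. L2_norm (\<lambda>x. truncate k g x - g x)) \<longlonglongrightarrow> 0"
  unfolding truncate_def
proof (rule L2_norm_tendsto_0_dominated[OF g])
  note [measurable] = L2_measurable[OF g] borel_measurable_lebesgue_ident
  fix x
  show "(\<lambda>k. if norm x \<le> real k \<and> cmod (g x) \<le> real k then 1 else 0 :: complex) \<longlonglongrightarrow> 1"
  proof (rule tendsto_eventually)
    obtain K where K: "max (norm x) (cmod (g x)) \<le> real K" using real_arch_simple by blast
    show "\<forall>\<^sub>F k in sequentially. (if norm x \<le> real k \<and> cmod (g x) \<le> real k then 1 else 0 :: complex) = 1"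
      using eventually_ge_at_top[of K] by eventually_elim (use K in auto)
  qed
  show "(\<lambda>x. if norm x \<le> real k \<and> cmod (g x) \<le> real k then 1 else 0 :: complex) \<in> borel_measurable lebesgue" for k
    by measurable
qed auto

text \<open>The Riesz--Fischer theorem. The Cauchy property is given through a null sequence \<open>a\<close>, the form
  in which it arises by comparing with a known limit through an isometry. Along a
  subsequence \<open>r\<close> with \<open>a (r k) < (1/4)^k\<close> the increments \<open>d k\<close> are so small that the
  weighted sum \<open>S\<close> of their squares, with weights \<open>4^k\<close>, is still integrable. Where \<open>S\<close>
  is finite, \<open>d k\<close> is bounded by a multiple of \<open>(1/2)^k\<close>, so the subsequence converges. Fatou's
  lemma then bounds the distance from the limit.\<close>

lemma L2_complete:
  fixes g :: "nat \<Rightarrow> real ^ 'n \<Rightarrow> complex"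
  assumes g: "\<And>k. g k \<in> L2" and a: "a \<longlonglongrightarrow> 0"
    and cauchy: "\<And>j k. L2_norm (\<lambda>x. g j x - g k x) \<le> a j + a k"
  shows "\<exists>G\<in>L2. (\<lambda>k. L2_norm (\<lambda>x. g k x - G x)) \<longlonglongrightarrow> 0"
proof -
  note [measurable] = L2_measurable[OF g]
  have "\<exists>j. a j < ennreal ((1/4)^k)" for k
    using order_tendstoD(2)[OF a, of "ennreal ((1/4)^k)"] by (auto simp: eventually_sequentially)
  then obtain r where r: "\<And>k. a (r k) < ennreal ((1/4)^k)" by metis
  define d where "d k x = g (r (Suc k)) x - g (r k) x" for k x
  have [measurable]: "d k \<in> borel_measurable lebesgue" for k unfolding d_def by measurable
  have d_le: "L2_norm (d k) \<le> ennreal (2 * (1/4)^k)" for k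
  proof -
    have "L2_norm (d k) \<le> a (r (Suc k)) + a (r k)" unfolding d_def by (rule cauchy)
    also have "\<dots> \<le> ennreal ((1/4)^Suc k) + ennreal ((1/4)^k)"
      by (intro add_mono less_imp_le r)
    also have "\<dots> \<le> ennreal (2 * (1/4)^k)" by (subst ennreal_plus[symmetric]) (auto intro!: ennreal_leI)
    finally show ?thesis .
  qed
  define S where "S x = (\<Sum>k. ennreal (4^k) * ennreal ((cmod (d k x))\<^sup>2))" for x
  have "(\<integral>\<^sup>+x. S x \<partial>lebesgue) = (\<Sum>k. ennreal (4^k) * (L2_norm (d k))\<^sup>2)"
    unfolding S_def L2_norm_def ennreal_sqrt_square
    by (subst nn_integral_suminf) (auto simp: nn_integral_cmult)
  also have "\<dots> \<le> (\<Sum>k. ennreal (4 * (1/4)^k))"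
  proof (intro suminf_le allI)
    fix k
    have "ennreal (4^k) * (L2_norm (d k))\<^sup>2 \<le> ennreal (4^k) * (ennreal (2 * (1/4)^k))\<^sup>2"
      by (intro mult_left_mono power_mono_ennreal d_le) auto
    also have "\<dots> = ennreal (4 * (1/4)^k)"
      by (simp add: ennreal_power ennreal_mult[symmetric] power_mult_distrib power2_eq_square field_simps)
    finally show "ennreal (4^k) * (L2_norm (d k))\<^sup>2 \<le> ennreal (4 * (1/4)^k)" .
  qed auto
  also have "\<dots> = ennreal (\<Sum>k. 4 * (1/4)^k)"
    by (rule suminf_ennreal2) (auto intro!: summable_mult summable_geometric)
  also have "\<dots> < \<infinity>" by simp
  finally have "AE x in lebesgue. S x \<noteq> \<infinity>"
    unfolding S_def by (intro nn_integral_PInf_AE) auto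
  then have conv: "AE x in lebesgue. convergent (\<lambda>k. g (r k) x)"
  proof eventually_elim
    fix x assume fin: "S x \<noteq> \<infinity>"
    define C where "C = sqrt (enn2real (S x))"
    have "cmod (d k x) \<le> C * (1/2)^k" for k
    proof -
      have "ennreal (4^k) * ennreal ((cmod (d k x))\<^sup>2) \<le> S x"
        unfolding S_def using sum_le_suminf[of "\<lambda>k. ennreal (4^k) * ennreal ((cmod (d k x))\<^sup>2)" "{k}"] by auto
      also have "\<dots> = ennreal (enn2real (S x))" using fin by (simp add: less_top)
      finally have "4^k * (cmod (d k x))\<^sup>2 \<le> enn2real (S x)"
        by (simp add: ennreal_mult[symmetric])
      moreover have "(4::real)^k = (2^k)\<^sup>2" by (simp add: power2_eq_square flip: power_mult_distrib)
      ultimately have "sqrt ((2^k * cmod (d k x))\<^sup>2) \<le> C"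
        unfolding C_def by (intro real_sqrt_le_mono) (simp add: power_mult_distrib)
      then have "2^k * cmod (d k x) \<le> C" by simp
      then show ?thesis by (simp add: field_simps)
    qed
    moreover have "summable (\<lambda>k. C * (1/2)^k)" by (intro summable_mult summable_geometric) simp
    ultimately have "summable (\<lambda>k. d k x)"
      using summable_comparison_test'[of "\<lambda>k. C * (1/2)^k" 0 "\<lambda>k. d k x"] by blast
    then have "convergent (\<lambda>k. (\<Sum>i<k. d i x) + g (r 0) x)"
      by (intro convergent_add convergent_const) (simp add: summable_iff_convergent)
    moreover have "(\<Sum>i<k. d i x) + g (r 0) x = g (r k) x" for k
      unfolding d_def by (induction k) (auto simp: algebra_simps)
    ultimately show "convergent (\<lambda>k. g (r k) x)" by simp
  qed
  define G where "G x = lim (\<lambda>k. g (r k) x)" for x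
  have [measurable]: "G \<in> borel_measurable lebesgue" unfolding G_def[abs_def] by measurable
  have G_le: "L2_norm (\<lambda>x. g j x - G x) \<le> a j" for j
  proof (rule ennreal_le_epsilon)
    fix e :: real assume e: "0 < e"
    have "(L2_norm (\<lambda>x. g j x - G x))\<^sup>2 = (\<integral>\<^sup>+x. liminf (\<lambda>k. ennreal ((cmod (g j x - g (r k) x))\<^sup>2)) \<partial>lebesgue)"
      unfolding L2_norm_def ennreal_sqrt_square
    proof (intro nn_integral_cong_AE, use conv in eventually_elim)
      fix x assume "convergent (\<lambda>k. g (r k) x)"
      then have "(\<lambda>k. g (r k) x) \<longlonglongrightarrow> G x" by (simp add: G_def convergent_LIMSEQ_iff)
      then have "(\<lambda>k. ennreal ((cmod (g j x - g (r k) x))\<^sup>2)) \<longlonglongrightarrow> ennreal ((cmod (g j x - G x))\<^sup>2)"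
        by (intro tendsto_intros)
      then show "ennreal ((cmod (g j x - G x))\<^sup>2) = liminf (\<lambda>k. ennreal ((cmod (g j x - g (r k) x))\<^sup>2))"
        by (rule lim_imp_Liminf[OF sequentially_bot, symmetric])
    qed
    also have "\<dots> \<le> liminf (\<lambda>k. \<integral>\<^sup>+x. ennreal ((cmod (g j x - g (r k) x))\<^sup>2) \<partial>lebesgue)"
      by (rule nn_integral_liminf) measurable
    also have "\<dots> \<le> liminf (\<lambda>k::nat. (a j + ennreal e)\<^sup>2)"
    proof (rule Liminf_mono)
      obtain N where N: "(1/4::real)^N < e" using e real_arch_pow_inv[of e "1/4"] by auto
      show "\<forall>\<^sub>F k in sequentially. (\<integral>\<^sup>+x. ennreal ((cmod (g j x - g (r k) x))\<^sup>2) \<partial>lebesgue) \<le> (a j + ennreal e)\<^sup>2"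
        using eventually_ge_at_top[of N]
      proof eventually_elim
        fix k assume k: "N \<le> k"
        have "L2_norm (\<lambda>x. g j x - g (r k) x) \<le> a j + a (r k)" by (rule cauchy)
        also have "\<dots> \<le> a j + ennreal e"
        proof (intro add_left_mono)
          have "(1/4::real)^k \<le> (1/4)^N" using k by (intro power_decreasing) auto
          then show "a (r k) \<le> ennreal e" using r[of k] N
            by (meson ennreal_leI less_imp_le order_trans)
        qed
        finally have "(L2_norm (\<lambda>x. g j x - g (r k) x))\<^sup>2 \<le> (a j + ennreal e)\<^sup>2" by (rule power_mono_ennreal)
        then show "(\<integral>\<^sup>+x. ennreal ((cmod (g j x - g (r k) x))\<^sup>2) \<partial>lebesgue) \<le> (a j + ennreal e)\<^sup>2"
          by (simp add: L2_norm_def)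
      qed
    qed
    also have "\<dots> = (a j + ennreal e)\<^sup>2" by (simp add: Liminf_const)
    finally show "L2_norm (\<lambda>x. g j x - G x) \<le> a j + ennreal e" by (simp only: ennreal_power2_le_iff)
  qed
  have "a (r 0) < \<infinity>" using r[of 0] by (auto intro: less_trans)
  then have "(\<lambda>x. g (r 0) x - G x) \<in> L2"
    using G_le[of "r 0"] by (auto simp: L2_def intro: le_less_trans)
  from L2_diff[OF g[of "r 0"] this] have "G \<in> L2" by simp
  moreover have "(\<lambda>k. L2_norm (\<lambda>x. g k x - G x)) \<longlonglongrightarrow> 0"
    using tendsto_sandwich[OF _ _ tendsto_const a] G_le by auto
  ultimately show ?thesis by blast
qed

section \<open>The Gaussian and its Fourier transform\<close>

lemma
  fixes f :: "'a::euclidean_space \<Rightarrow> real \<Rightarrow> complex"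
  assumes f: "\<And>b. b \<in> Basis \<Longrightarrow> integrable lborel (f b)"
  shows integrable_lborel_prod: "integrable lborel (\<lambda>x::'a. \<Prod>b\<in>Basis. f b (x \<bullet> b))" (is ?A)
    and integral_lborel_prod: "(LINT x|lborel. (\<Prod>b\<in>Basis. f b ((x::'a) \<bullet> b))) = (\<Prod>b\<in>Basis. LINT t|lborel. f b t)" (is ?B)
proof -
  interpret product_sigma_finite "\<lambda>_::'a. lborel :: real measure" ..
  have [measurable]: "f b \<in> borel_measurable borel" if "b \<in> Basis" for b
    using borel_measurable_integrable[OF f[OF that]] by simp
  let ?P = "\<Pi>\<^sub>M b\<in>(Basis::'a set). (lborel :: real measure)"
  let ?T = "\<lambda>x. \<Sum>b\<in>(Basis::'a set). x b *\<^sub>R b"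
  have [measurable]: "?T \<in> measurable ?P borel" by measurable
  have [measurable]: "(\<lambda>x::'a. \<Prod>b\<in>Basis. f b (x \<bullet> b)) \<in> borel_measurable borel" by measurable
  have T: "(\<Prod>b\<in>Basis. f b (?T x \<bullet> b)) = (\<Prod>b\<in>Basis. f b (x b))" for x
    by (rule prod.cong) auto
  show ?A
    by (subst lborel_eq, subst integrable_distr_eq) (measurable, simp only: T, rule product_integrable_prod[OF finite_Basis f])
  show ?B
    by (subst lborel_eq, subst integral_distr) (measurable, simp only: T, rule product_integral_prod[OF finite_Basis f])
qed

text \<open>The standard normal density, normalised so that it is its own unitary Fourier transform.\<close>

definition gauss :: "real ^ 'n \<Rightarrow> real" where
  "gauss x = (2 * pi) powr (- real CARD('n) / 2) * exp (- (norm x)\<^sup>2 / 2)"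

lemma gauss_eq_prod:
  fixes x :: "real ^ 'n"
  shows "gauss x = (\<Prod>b\<in>Basis. std_normal_density (x \<bullet> b))"
proof -
  have "(norm x)\<^sup>2 = (\<Sum>b\<in>Basis. (x \<bullet> b)\<^sup>2)"
    unfolding power2_norm_eq_inner by (subst euclidean_inner) (simp add: power2_eq_square)
  then have "exp (- (norm x)\<^sup>2 / 2) = (\<Prod>b\<in>Basis. exp (- (x \<bullet> b)\<^sup>2 / 2))"
    by (simp add: exp_sum[symmetric] sum_divide_distrib sum_negf)
  moreover have "(\<Prod>b\<in>(Basis::(real^'n) set). 1 / sqrt (2 * pi)) = (2 * pi) powr (- real CARD('n) / 2)"
  proof -
    have "1 / sqrt (2 * pi) = (2 * pi) powr (- 1 / 2)"
      using powr_minus_divide[of "2 * pi" "1 / 2"] by (simp add: powr_half_sqrt)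
    then show ?thesis by (simp add: powr_power)
  qed
  ultimately show ?thesis
    unfolding gauss_def std_normal_density_def prod.distrib by simp
qed

text \<open>The Gaussian is a product of one-dimensional normal densities and the character is a product as
  well, so the integral factors into values of the characteristic function of the
  standard normal distribution.\<close>

lemma
  fixes \<xi> :: "real ^ 'n"
  shows gauss_cis_integrable: "integrable lborel (\<lambda>w. exp (\<i> * complex_of_real (\<xi> \<bullet> w)) * complex_of_real (gauss w))"
    and integral_gauss_cis: "(\<integral>w. exp (\<i> * complex_of_real (\<xi> \<bullet> w)) * complex_of_real (gauss w) \<partial>lborel)
           = complex_of_real (exp (- (norm \<xi>)\<^sup>2 / 2))"
proof -
  let ?f = "\<lambda>b t. exp (\<i> * complex_of_real ((\<xi> \<bullet> b) * t)) * complex_of_real (std_normal_density t)"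
  have eq: "exp (\<i> * complex_of_real (\<xi> \<bullet> w)) * complex_of_real (gauss w) = (\<Prod>b\<in>Basis. ?f b (w \<bullet> b))" for w
    by (simp add: gauss_eq_prod prod.distrib euclidean_inner[of \<xi> w] exp_sum[symmetric] sum_distrib_left)
  have int: "integrable lborel (?f b)" for b
    by (rule Bochner_Integration.integrable_bound[OF integrable_normal_density[of 1 0]])
       (auto simp: norm_mult)
  have one: "(\<integral>t. ?f b t \<partial>lborel) = complex_of_real (exp (- (\<xi> \<bullet> b)\<^sup>2 / 2))" for b
  proof -
    have "complex_of_real (exp (- (\<xi> \<bullet> b)\<^sup>2 / 2)) = char std_normal_distribution (\<xi> \<bullet> b)"
      by (simp add: char_std_normal_distribution)
    also have "\<dots> = (\<integral>t. ?f b t \<partial>lborel)"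
      unfolding char_def by (subst integral_density) (auto simp: scaleR_conv_of_real mult.commute)
    finally show ?thesis ..
  qed
  show "integrable lborel (\<lambda>w. exp (\<i> * complex_of_real (\<xi> \<bullet> w)) * complex_of_real (gauss w))"
    unfolding eq by (rule integrable_lborel_prod[OF int])
  have nrm: "(norm \<xi>)\<^sup>2 = (\<Sum>b\<in>Basis. (\<xi> \<bullet> b)\<^sup>2)"
    unfolding power2_norm_eq_inner by (subst euclidean_inner) (simp add: power2_eq_square)
  show "(\<integral>w. exp (\<i> * complex_of_real (\<xi> \<bullet> w)) * complex_of_real (gauss w) \<partial>lborel)
           = complex_of_real (exp (- (norm \<xi>)\<^sup>2 / 2))"
  proof -
    have "(\<Prod>b\<in>Basis. complex_of_real (exp (- (\<xi> \<bullet> b)\<^sup>2 / 2)))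
        = complex_of_real (exp (\<Sum>b\<in>Basis. - (\<xi> \<bullet> b)\<^sup>2 / 2))"
      by (simp only: exp_sum[OF finite_Basis] of_real_prod)
    also have "(\<Sum>b\<in>Basis. - (\<xi> \<bullet> b)\<^sup>2 / 2) = - (norm \<xi>)\<^sup>2 / 2"
      by (simp add: nrm sum_divide_distrib sum_negf)
    finally show ?thesis
      unfolding eq integral_lborel_prod[OF int] one .
  qed
qed

lemma gauss_nonneg [simp]: "0 \<le> gauss x"
  by (simp add: gauss_def)

lemma gauss_measurable [measurable]: "gauss \<in> borel_measurable borel"
  unfolding gauss_def[abs_def] by measurable

lemma integrable_gauss: "integrable lborel (gauss :: real ^ 'n \<Rightarrow> real)"
  using gauss_cis_integrable[of "0 :: real^'n"] by (simp add: complex_of_real_integrable_eq)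

lemma integral_gauss: "(\<integral>w. gauss w \<partial>(lborel :: (real^'n) measure)) = 1"
  using integral_gauss_cis[of "0 :: real^'n"] by simp

lemma nn_integral_gauss: "(\<integral>\<^sup>+w. ennreal (gauss w) \<partial>(lborel :: (real^'n) measure)) = 1"
  by (subst nn_integral_eq_integral[OF integrable_gauss]) (auto simp: integral_gauss)

section \<open>Translation is continuous in L2\<close>

lemma tendsto_0_le_ennreal:
  assumes "\<And>k. f k \<le> g k" and "(g \<longlongrightarrow> 0) F"
  shows "(f \<longlongrightarrow> (0::ennreal)) F"
  by (rule tendsto_sandwich[OF _ _ tendsto_const assms(2)]) (auto simp: assms(1))

lemma lborel_translate_nn:
  fixes v :: "'a::euclidean_space"
  assumes [measurable]: "f \<in> borel_measurable borel"
  shows "(\<integral>\<^sup>+x. f (x + v) \<partial>lborel) = (\<integral>\<^sup>+x. f x \<partial>lborel)"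
  by (subst (2) lborel_distr_plus[of v, symmetric]) (simp add: nn_integral_distr add.commute)

lemma lborel_integrable_affine:
  fixes f :: "'a::euclidean_space \<Rightarrow> 'b::{banach, second_countable_topology}"
  assumes f: "integrable lborel f" and c: "c \<noteq> 0"
  shows "integrable lborel (\<lambda>x. f (t + c *\<^sub>R x))"
proof -
  have [measurable]: "f \<in> borel_measurable borel" using borel_measurable_integrable[OF f] by simp
  have "integrable (density (distr lborel borel (\<lambda>x. t + c *\<^sub>R x)) (\<lambda>_. ennreal (\<bar>c\<bar>^DIM('a)))) f"
    using f lborel_affine[OF c, of t] by (metis ennreal_power abs_ge_zero)
  then show ?thesis
    using c integrable_scaleR_right[of "1 / \<bar>c\<bar>^DIM('a)" lborel "\<lambda>x. \<bar>c\<bar>^DIM('a) *\<^sub>R f (t + c *\<^sub>R x)"]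
    by (simp add: integrable_density integrable_distr_eq)
qed

lemma lborel_integral_affine:
  fixes f :: "'a::euclidean_space \<Rightarrow> 'b::{banach, second_countable_topology}"
  assumes [measurable]: "f \<in> borel_measurable borel" and c: "c \<noteq> 0"
  shows "(\<integral>x. f x \<partial>lborel) = \<bar>c\<bar>^DIM('a) *\<^sub>R (\<integral>x. f (t + c *\<^sub>R x) \<partial>lborel)"
proof -
  have "(\<integral>x. f x \<partial>lborel) = (\<integral>x. f x \<partial>density (distr lborel borel (\<lambda>x. t + c *\<^sub>R x)) (\<lambda>_. ennreal (\<bar>c\<bar>^DIM('a))))"
    using lborel_affine[OF c, of t] by (metis ennreal_power abs_ge_zero)
  also have "\<dots> = \<bar>c\<bar>^DIM('a) *\<^sub>R (\<integral>x. f (t + c *\<^sub>R x) \<partial>lborel)"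
    by (simp add: integral_density integral_distr)
  finally show ?thesis .
qed

lemma lborel_integrable_translate:
  fixes f :: "'a::euclidean_space \<Rightarrow> 'b::{banach, second_countable_topology}"
  assumes "integrable lborel f"
  shows "integrable lborel (\<lambda>x. f (x + v))"
  using lborel_integrable_affine[OF assms, of 1 v] by (simp add: add.commute)

lemma gauss_pos [simp]: "0 < gauss x"
  by (simp add: gauss_def)

text \<open>For \<open>c \<ge> 0\<close>, \<open>clip c\<close> is the retraction of the line onto \<open>[-c, c]\<close>. It is continuous in \<open>c\<close> and \<open>t\<close>
  jointly, so clipping a continuous function at a continuous level keeps it continuous.\<close>

definition clip :: "real \<Rightarrow> real \<Rightarrow> real" where
  "clip c t = max (- c) (min c t)"

text \<open>A measurable function is almost everywhere a limit of continuous functions \<open>g n\<close>, but these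
  need not be dominated. Clipping at the level \<open>k * gauss\<close> repairs this: it changes \<open>h\<close> little
  for large \<open>k\<close>, as the Gaussian is positive everywhere, and for fixed \<open>k\<close> the clipped \<open>g n\<close> are
  dominated by an integrable function.\<close>

lemma approximate_continuous_L1:
  fixes h :: "real ^ 'n \<Rightarrow> real"
  assumes h: "integrable lborel h" and e: "0 < e"
  shows "\<exists>d. continuous_on UNIV d \<and> integrable lborel d \<and> (\<integral>\<^sup>+x. ennreal (norm (h x - d x)) \<partial>lborel) < ennreal e"
proof -
  have hb [measurable]: "h \<in> borel_measurable borel" using borel_measurable_integrable[OF h] by simp
  have "h measurable_on UNIV"
    using hb by (intro lebesgue_measurable_imp_measurable_on measurable_completion) auto
  then obtain N g where N: "negligible N" and g: "\<And>n. continuous_on UNIV (g n)"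
    and gh: "\<And>x. x \<notin> N \<Longrightarrow> (\<lambda>n. g n x) \<longlonglongrightarrow> h x"
    unfolding measurable_on_def by auto
  have [measurable]: "g n \<in> borel_measurable borel" for n
    using g by (rule borel_measurable_continuous_onI)
  have [measurable]: "(\<lambda>x. clip (real k * gauss x) (f x)) \<in> borel_measurable borel"
    if [measurable]: "f \<in> borel_measurable borel" for f :: "real^'n \<Rightarrow> real" and k :: nat
    unfolding clip_def by measurable
  have AE_gh: "AE x in lborel. (\<lambda>n. g n x) \<longlonglongrightarrow> h x"
  proof -
    have "AE x in lebesgue. x \<notin> N"
      using N by (simp add: AE_not_in negligible_iff_null_sets)
    then show ?thesis unfolding AE_completion_iff by eventually_elim (rule gh)
  qed
  have "(\<lambda>k. \<integral>\<^sup>+x. ennreal (norm (h x - clip (real k * gauss x) (h x))) \<partial>lborel) \<longlonglongrightarrow> 0"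
  proof (rule nn_integral_dominated_convergence_norm[where w = "\<lambda>x. norm (h x)"])
    show "(\<integral>\<^sup>+x. ennreal (norm (h x)) \<partial>lborel) < \<infinity>"
      using h by (simp add: integrable_iff_bounded)
    have "norm (clip (real k * gauss x) (h x)) \<le> norm (h x)" for k x
      using mult_nonneg_nonneg[of "real k" "gauss x"] by (auto simp: clip_def max_def min_def)
    then show "AE x in lborel. norm (clip (real k * gauss x) (h x)) \<le> norm (h x)" for k
      by simp
    show "AE x in lborel. (\<lambda>k. clip (real k * gauss x) (h x)) \<longlonglongrightarrow> h x"
    proof (intro AE_I2 tendsto_eventually)
      fix x :: "real ^ 'n"
      obtain K where K: "\<bar>h x\<bar> / gauss x \<le> real K" using real_arch_simple by blast
      show "\<forall>\<^sub>F k in sequentially. clip (real k * gauss x) (h x) = h x"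
        using eventually_ge_at_top[of K]
      proof eventually_elim
        fix k assume "K \<le> k"
        then have "\<bar>h x\<bar> \<le> real k * gauss x"
          using K by (simp add: field_simps) (smt (verit) gauss_pos mult_right_mono of_nat_mono)
        then show "clip (real k * gauss x) (h x) = h x" by (auto simp: clip_def)
      qed
    qed
  qed measurable
  then have "\<forall>\<^sub>F k in sequentially. (\<integral>\<^sup>+x. ennreal (norm (h x - clip (real k * gauss x) (h x))) \<partial>lborel) < ennreal (e / 2)"
    using e by (auto dest!: order_tendstoD(2)[where a = "ennreal (e / 2)"])
  then obtain k where k: "(\<integral>\<^sup>+x. ennreal (norm (h x - clip (real k * gauss x) (h x))) \<partial>lborel) < ennreal (e / 2)"
    by (auto simp: eventually_sequentially)
  have clip_bd: "norm (clip (real k * gauss x) t) \<le> real k * gauss x" for x :: "real^'n" and t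
    using mult_nonneg_nonneg[of "real k" "gauss x"] by (auto simp: clip_def max_def min_def)
  have int_k: "integrable lborel (\<lambda>x::real^'n. real k * gauss x)"
    by (intro integrable_mult_right integrable_gauss)
  have "(\<lambda>n. \<integral>\<^sup>+x. ennreal (norm (clip (real k * gauss x) (h x) - clip (real k * gauss x) (g n x))) \<partial>lborel) \<longlonglongrightarrow> 0"
  proof (rule nn_integral_dominated_convergence_norm[where w = "\<lambda>x. real k * gauss x"])
    show "(\<integral>\<^sup>+x. ennreal (real k * gauss x) \<partial>(lborel :: (real^'n) measure)) < \<infinity>"
      by (subst nn_integral_eq_integral[OF int_k]) auto
    show "AE x in lborel. (\<lambda>n. clip (real k * gauss x) (g n x)) \<longlonglongrightarrow> clip (real k * gauss x) (h x)"
      using AE_gh by eventually_elim (unfold clip_def, intro tendsto_max tendsto_min tendsto_const)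
  qed (use clip_bd in simp_all)
  then have "\<forall>\<^sub>F n in sequentially. (\<integral>\<^sup>+x. ennreal (norm (clip (real k * gauss x) (h x) - clip (real k * gauss x) (g n x))) \<partial>lborel) < ennreal (e / 2)"
    using e by (auto dest!: order_tendstoD(2)[where a = "ennreal (e / 2)"])
  then obtain n where n: "(\<integral>\<^sup>+x. ennreal (norm (clip (real k * gauss x) (h x) - clip (real k * gauss x) (g n x))) \<partial>lborel) < ennreal (e / 2)"
    by (auto simp: eventually_sequentially)
  let ?d = "\<lambda>x. clip (real k * gauss x) (g n x)"
  have "continuous_on UNIV ?d"
    unfolding clip_def gauss_def by (intro continuous_intros g) auto
  moreover have "integrable lborel ?d"
    by (rule Bochner_Integration.integrable_bound[OF int_k]) (use clip_bd in \<open>auto intro!: always_eventually\<close>)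
  moreover have "(\<integral>\<^sup>+x. ennreal (norm (h x - ?d x)) \<partial>lborel) < ennreal e"
  proof -
    have "(\<integral>\<^sup>+x. ennreal (norm (h x - ?d x)) \<partial>lborel) \<le>
      (\<integral>\<^sup>+x. ennreal (norm (h x - clip (real k * gauss x) (h x))) + ennreal (norm (clip (real k * gauss x) (h x) - ?d x)) \<partial>lborel)"
      by (intro nn_integral_mono) (auto simp: ennreal_plus[symmetric] simp del: ennreal_plus intro!: ennreal_leI)
    also have "\<dots> = (\<integral>\<^sup>+x. ennreal (norm (h x - clip (real k * gauss x) (h x))) \<partial>lborel)
        + (\<integral>\<^sup>+x. ennreal (norm (clip (real k * gauss x) (h x) - ?d x)) \<partial>lborel)"
      by (rule nn_integral_add) auto
    also have "\<dots> < ennreal (e / 2) + ennreal (e / 2)"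
      using k n by (rule add_strict_mono)
    also have "\<dots> = ennreal e" using e by (simp flip: ennreal_plus)
    finally show ?thesis .
  qed
  ultimately show ?thesis by blast
qed

text \<open>For a continuous integrable \<open>d\<close> the translates converge pointwise and have the same \<open>L1\<close> norm, so
  they converge in \<open>L1\<close> by Scheffe's lemma. Approximation carries this over to \<open>h\<close>, since
  translations preserve the \<open>L1\<close> distance.\<close>

lemma L1_translation_continuous:
  fixes h :: "real ^ 'n \<Rightarrow> real"
  assumes h: "integrable lborel h" and v: "v \<longlonglongrightarrow> 0"
  shows "(\<lambda>j. \<integral>\<^sup>+x. ennreal (norm (h (x + v j) - h x)) \<partial>lborel) \<longlonglongrightarrow> 0"
proof (rule order_tendstoI)
  fix e :: ennreal assume "0 < e"
  then obtain r where r: "0 < ennreal r" "ennreal r < e" "0 < r"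
    by (metis dense ennreal_cases ennreal_less_zero_iff less_top_ennreal order_less_trans)
  obtain d where d: "continuous_on UNIV d" "integrable lborel d"
    and hd: "(\<integral>\<^sup>+x. ennreal (norm (h x - d x)) \<partial>lborel) < ennreal (r / 3)"
    using approximate_continuous_L1[OF h, of "r / 3"] r by auto
  have [measurable]: "h \<in> borel_measurable borel" "d \<in> borel_measurable borel"
    using borel_measurable_integrable[OF h] borel_measurable_integrable[OF d(2)] by simp_all
  have "(\<lambda>j. \<integral>\<^sup>+x. ennreal (norm (d (x + v j) - d x)) \<partial>lborel) \<longlonglongrightarrow> 0"
  proof (rule Scheffe_lemma1)
    show "integrable lborel (\<lambda>x. d (x + v j))" for j
      by (rule lborel_integrable_translate[OF d(2)])
    have "(\<lambda>j. d (x + v j)) \<longlonglongrightarrow> d (x + 0)" for x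
    proof (rule isCont_tendsto_compose[of _ d])
      show "isCont d (x + 0)" using d(1) by (simp add: continuous_on_eq_continuous_at)
      show "(\<lambda>j. x + v j) \<longlonglongrightarrow> x + 0" by (intro tendsto_intros v)
    qed
    then show "AE x in lborel. (\<lambda>j. d (x + v j)) \<longlonglongrightarrow> d x" by simp
    have "(\<integral>\<^sup>+x. ennreal (norm (d (x + v j))) \<partial>lborel) = (\<integral>\<^sup>+x. ennreal (norm (d x)) \<partial>lborel)" for j
      by (rule lborel_translate_nn) measurable
    then show "limsup (\<lambda>j. \<integral>\<^sup>+x. ennreal (norm (d (x + v j))) \<partial>lborel) \<le> (\<integral>\<^sup>+x. ennreal (norm (d x)) \<partial>lborel)"
      by (simp add: Limsup_const)
  qed (fact d(2))
  then have "\<forall>\<^sub>F j in sequentially. (\<integral>\<^sup>+x. ennreal (norm (d (x + v j) - d x)) \<partial>lborel) < ennreal (r / 3)"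
    using r by (auto dest!: order_tendstoD(2)[where a = "ennreal (r / 3)"])
  then show "\<forall>\<^sub>F j in sequentially. (\<integral>\<^sup>+x. ennreal (norm (h (x + v j) - h x)) \<partial>lborel) < e"
  proof eventually_elim
    fix j assume j: "(\<integral>\<^sup>+x. ennreal (norm (d (x + v j) - d x)) \<partial>lborel) < ennreal (r / 3)"
    have "(\<integral>\<^sup>+x. ennreal (norm (h (x + v j) - h x)) \<partial>lborel) \<le>
      (\<integral>\<^sup>+x. ennreal (norm (h (x + v j) - d (x + v j))) + (ennreal (norm (d (x + v j) - d x)) + ennreal (norm (h x - d x))) \<partial>lborel)"
      by (intro nn_integral_mono) (auto simp: ennreal_plus[symmetric] simp del: ennreal_plus intro!: ennreal_leI)
    also have "\<dots> = (\<integral>\<^sup>+x. ennreal (norm (h (x + v j) - d (x + v j))) \<partial>lborel) +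
       ((\<integral>\<^sup>+x. ennreal (norm (d (x + v j) - d x)) \<partial>lborel) + (\<integral>\<^sup>+x. ennreal (norm (h x - d x)) \<partial>lborel))"
      by (simp add: nn_integral_add)
    also have "(\<integral>\<^sup>+x. ennreal (norm (h (x + v j) - d (x + v j))) \<partial>lborel) = (\<integral>\<^sup>+x. ennreal (norm (h x - d x)) \<partial>lborel)"
      by (rule lborel_translate_nn[where f = "\<lambda>x. ennreal (norm (h x - d x))"]) measurable
    also have "(\<integral>\<^sup>+x. ennreal (norm (h x - d x)) \<partial>lborel) +
       ((\<integral>\<^sup>+x. ennreal (norm (d (x + v j) - d x)) \<partial>lborel) + (\<integral>\<^sup>+x. ennreal (norm (h x - d x)) \<partial>lborel))
       < ennreal (r / 3) + (ennreal (r / 3) + ennreal (r / 3))"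
      by (intro add_strict_mono hd j)
    also have "\<dots> = ennreal r" using r by (simp flip: ennreal_plus)
    finally show "(\<integral>\<^sup>+x. ennreal (norm (h (x + v j) - h x)) \<partial>lborel) < e" using r(2) by (rule less_trans)
  qed
qed auto

text \<open>The signed square \<open>t * \<bar>t\<bar>\<close> turns a function in \<open>L2\<close> into one in \<open>L1\<close>. This inequality says
  that \<open>L1\<close> convergence of signed squares forces \<open>L2\<close> convergence.\<close>

lemma power2_diff_le_signed_squares:
  fixes a b :: real
  shows "(a - b)\<^sup>2 \<le> 2 * \<bar>a * \<bar>a\<bar> - b * \<bar>b\<bar>\<bar>"
proof -
  have *: "(a - b)\<^sup>2 \<le> 2 * \<bar>a * a - b * b\<bar>" if "0 \<le> a" "0 \<le> b" for a b :: real
  proof -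
    have "(a - b)\<^sup>2 = \<bar>a - b\<bar> * \<bar>a - b\<bar>" by (simp add: power2_eq_square)
    also have "\<dots> \<le> \<bar>a - b\<bar> * (a + b)" using that by (intro mult_left_mono) auto
    also have "\<dots> = \<bar>a * a - b * b\<bar>"
      using that by (simp add: abs_mult square_diff_square_factored mult.commute)
    also have "\<dots> \<le> 2 * \<bar>a * a - b * b\<bar>" by simp
    finally show ?thesis .
  qed
  have **: "(a - b)\<^sup>2 \<le> 2 * (a * a + b * b)" for a b :: real
    using zero_le_power2[of "a + b"] by (simp add: power2_eq_square algebra_simps)
  consider "0 \<le> a" "0 \<le> b" | "a < 0" "b < 0" | "0 \<le> a" "b < 0" | "a < 0" "0 \<le> b" by linarith
  then show ?thesis
  proof cases
    case 1 then show ?thesis using *[of a b] by simp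
  next
    case 2 then show ?thesis using *[of "-a" "-b"] by (simp add: power2_commute abs_minus_commute)
  next
    case 3 then show ?thesis using **[of a b] mult_nonneg_nonneg[of a a] by (simp add: abs_if)
  next
    case 4 then show ?thesis using **[of a b] mult_nonneg_nonneg[of b b] by (simp add: abs_if)
  qed
qed

lemma L2_borel_nn_integral_finite:
  assumes "g \<in> L2"
  shows "(\<integral>\<^sup>+x. ennreal ((cmod (g x))\<^sup>2) \<partial>lborel) < \<infinity>"
proof -
  have "(L2_norm g)\<^sup>2 < \<infinity>" using assms by (simp add: L2_def power_less_top_ennreal)
  then show ?thesis by (simp only: L2_norm_power2)
qed

text \<open>Apply continuity in \<open>L1\<close> to the signed squares of the real and imaginary parts.\<close>

lemma L2_translation_continuous:
  fixes g :: "real ^ 'n \<Rightarrow> complex"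
  assumes g: "g \<in> L2" and gb [measurable]: "g \<in> borel_measurable borel" and v: "v \<longlonglongrightarrow> 0"
  shows "(\<lambda>j. \<integral>\<^sup>+x. ennreal ((cmod (g (x + v j) - g x))\<^sup>2) \<partial>lborel) \<longlonglongrightarrow> 0"
proof -
  let ?q = "\<lambda>t::real. t * \<bar>t\<bar>"
  let ?D = "\<lambda>p j. \<integral>\<^sup>+x. ennreal (norm (?q (p (g (x + v j))) - ?q (p (g x)))) \<partial>lborel"
  have int: "integrable lborel (\<lambda>x. (cmod (g x))\<^sup>2)"
    using L2_borel_nn_integral_finite[OF g] by (intro integrableI_bounded) auto
  have re: "(\<lambda>j. ?D Re j) \<longlonglongrightarrow> 0"
    by (intro L1_translation_continuous v Bochner_Integration.integrable_bound[OF int])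
       (auto simp: abs_mult cmod_power2 simp flip: power2_eq_square)
  have im: "(\<lambda>j. ?D Im j) \<longlonglongrightarrow> 0"
    by (intro L1_translation_continuous v Bochner_Integration.integrable_bound[OF int])
       (auto simp: abs_mult cmod_power2 simp flip: power2_eq_square)
  have "(\<integral>\<^sup>+x. ennreal ((cmod (g (x + v j) - g x))\<^sup>2) \<partial>lborel) \<le> 2 * (?D Re j + ?D Im j)" for j
  proof -
    have "(\<integral>\<^sup>+x. ennreal ((cmod (g (x + v j) - g x))\<^sup>2) \<partial>lborel) \<le>
      (\<integral>\<^sup>+x. ennreal 2 * (ennreal (norm (?q (Re (g (x + v j))) - ?q (Re (g x))))
             + ennreal (norm (?q (Im (g (x + v j))) - ?q (Im (g x))))) \<partial>lborel)"
    proof (intro nn_integral_mono)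
      fix x
      show "ennreal ((cmod (g (x + v j) - g x))\<^sup>2) \<le> ennreal 2 * (ennreal (norm (?q (Re (g (x + v j))) - ?q (Re (g x))))
             + ennreal (norm (?q (Im (g (x + v j))) - ?q (Im (g x)))))"
        using power2_diff_le_signed_squares[of "Re (g (x + v j))" "Re (g x)"]
          power2_diff_le_signed_squares[of "Im (g (x + v j))" "Im (g x)"]
        by (subst ennreal_plus[symmetric], simp, simp, subst ennreal_mult[symmetric])
           (auto simp: cmod_power2 simp del: ennreal_plus intro!: ennreal_leI)
    qed
    also have "\<dots> = 2 * (?D Re j + ?D Im j)"
      by (subst nn_integral_cmult) (auto simp: nn_integral_add)
    finally show ?thesis .
  qed
  moreover have "(\<lambda>j. 2 * (?D Re j + ?D Im j)) \<longlonglongrightarrow> 2 * (0 + 0)"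
    by (intro tendsto_add re im ennreal_tendsto_cmult) auto
  ultimately show ?thesis by (metis (no_types, lifting) tendsto_0_le_ennreal add_0 mult_zero_right)
qed

section \<open>Gaussian means\<close>

definition gauss_mean :: "real \<Rightarrow> (real ^ 'n \<Rightarrow> complex) \<Rightarrow> real ^ 'n \<Rightarrow> complex" where
  "gauss_mean s g x = (\<integral>w. complex_of_real (gauss w) * g (x + s *\<^sub>R w) \<partial>lborel)"

lemma gauss_le: "gauss (x :: real ^ 'n) \<le> (2 * pi) powr (- real CARD('n) / 2)"
  by (simp add: gauss_def mult_left_le)

lemma gauss_mean_integrable:
  fixes g :: "real ^ 'n \<Rightarrow> complex"
  assumes g: "integrable lborel g" and s: "s \<noteq> 0"
  shows "integrable lborel (\<lambda>w. complex_of_real (gauss w) * g (x + s *\<^sub>R w))"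
proof -
  have [measurable]: "g \<in> borel_measurable borel" using borel_measurable_integrable[OF g] by simp
  have "integrable lborel (\<lambda>w. complex_of_real ((2 * pi) powr (- real CARD('n) / 2)) * g (x + s *\<^sub>R w))"
    by (intro integrable_mult_right lborel_integrable_affine[OF g s])
  moreover have "(\<lambda>w. complex_of_real (gauss w) * g (x + s *\<^sub>R w)) \<in> borel_measurable lborel" by measurable
  moreover have "AE w in lborel. norm (complex_of_real (gauss w) * g (x + s *\<^sub>R w)) \<le>
      norm (complex_of_real ((2 * pi) powr (- real CARD('n) / 2)) * g (x + s *\<^sub>R w))"
    by (intro AE_I2) (auto simp: norm_mult intro!: mult_right_mono order_trans[OF gauss_le])
  ultimately show ?thesis by (rule Bochner_Integration.integrable_bound)
qed

lemma gauss_mean_measurable [measurable]: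
  fixes g :: "real ^ 'n \<Rightarrow> complex"
  assumes [measurable]: "g \<in> borel_measurable borel"
  shows "gauss_mean s g \<in> borel_measurable borel"
  unfolding gauss_mean_def[abs_def] by measurable

text \<open>As the Gaussian is a probability density, \<open>gauss_mean s g x - g x\<close> is an average of increments
  \<open>g (x + s w) - g x\<close>, and Cauchy--Schwarz bounds its square by the average of their squares.
  Integrating over \<open>x\<close> leaves the average of \<open>\<omega> (s w)\<close>, where \<open>\<omega> v\<close> is the squared
  \<open>L2\<close> modulus of continuity of \<open>g\<close> at displacement \<open>v\<close>: it is bounded and tends to 0 with \<open>v\<close>.\<close>

lemma gauss_mean_tendsto_L2:
  fixes g :: "real ^ 'n \<Rightarrow> complex"
  assumes gi: "integrable lborel g" and g: "g \<in> L2"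
    and s0: "\<And>k. s k \<noteq> 0" and s: "s \<longlonglongrightarrow> 0"
  shows "(\<lambda>k. L2_norm (\<lambda>x. gauss_mean (s k) g x - g x)) \<longlonglongrightarrow> 0"
proof -
  have gb [measurable]: "g \<in> borel_measurable borel" using borel_measurable_integrable[OF gi] by simp
  define \<omega> where "\<omega> v = (\<integral>\<^sup>+x. ennreal ((cmod (g (x + v) - g x))\<^sup>2) \<partial>lborel)" for v
  have [measurable]: "\<omega> \<in> borel_measurable borel" unfolding \<omega>_def[abs_def] by measurable
  define E where "E = (\<integral>\<^sup>+x. ennreal ((cmod (g x))\<^sup>2) \<partial>lborel)"
  have E: "E < \<infinity>" unfolding E_def by (rule L2_borel_nn_integral_finite[OF g])
  have \<omega>_le: "\<omega> v \<le> 4 * E" for v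
  proof -
    have "\<omega> v \<le> (\<integral>\<^sup>+x. ennreal 2 * (ennreal ((cmod (g (x + v)))\<^sup>2) + ennreal ((cmod (g x))\<^sup>2)) \<partial>lborel)"
      unfolding \<omega>_def
    proof (intro nn_integral_mono)
      fix x
      have "(cmod (g (x + v) - g x))\<^sup>2 \<le> (cmod (g (x + v)) + cmod (g x))\<^sup>2"
        by (intro power_mono norm_triangle_ineq4) auto
      also have "\<dots> \<le> 2 * ((cmod (g (x + v)))\<^sup>2 + (cmod (g x))\<^sup>2)"
        using zero_le_power2[of "cmod (g (x + v)) - cmod (g x)"] by (simp add: power2_eq_square algebra_simps)
      finally show "ennreal ((cmod (g (x + v) - g x))\<^sup>2) \<le> ennreal 2 * (ennreal ((cmod (g (x + v)))\<^sup>2) + ennreal ((cmod (g x))\<^sup>2))"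
        by (subst ennreal_plus[symmetric], simp, simp, subst ennreal_mult[symmetric])
           (auto simp del: ennreal_plus intro!: ennreal_leI)
    qed
    also have "\<dots> = 2 * ((\<integral>\<^sup>+x. ennreal ((cmod (g (x + v)))\<^sup>2) \<partial>lborel) + E)"
      by (subst nn_integral_cmult) (auto simp: nn_integral_add E_def)
    also have "(\<integral>\<^sup>+x. ennreal ((cmod (g (x + v)))\<^sup>2) \<partial>lborel) = E"
      unfolding E_def by (rule lborel_translate_nn[where f = "\<lambda>x. ennreal ((cmod (g x))\<^sup>2)"]) measurable
    also have "2 * (E + E) = 4 * E" by (simp add: mult_2[symmetric] mult.assoc[symmetric])
    finally show ?thesis .
  qed
  have pointwise: "ennreal ((cmod (gauss_mean (s k) g x - g x))\<^sup>2) \<le>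
      (\<integral>\<^sup>+w. ennreal (gauss w) * ennreal ((cmod (g (x + s k *\<^sub>R w) - g x))\<^sup>2) \<partial>lborel)" for k x
  proof -
    let ?D = "\<lambda>w. cmod (g (x + s k *\<^sub>R w) - g x)"
    have i1: "integrable lborel (\<lambda>w. complex_of_real (gauss w) * g (x + s k *\<^sub>R w))"
      by (rule gauss_mean_integrable[OF gi s0])
    have i2: "integrable lborel (\<lambda>w. complex_of_real (gauss (w::real^'n)) * g x)"
      using integrable_gauss by (intro integrable_mult_left) (simp add: complex_of_real_integrable_eq)
    have "g x = (\<integral>w. complex_of_real (gauss (w::real^'n)) * g x \<partial>lborel)"
      by (simp add: integral_gauss)
    then have "gauss_mean (s k) g x - g x = (\<integral>w. complex_of_real (gauss w) * g (x + s k *\<^sub>R w) - complex_of_real (gauss w) * g x \<partial>lborel)"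
      unfolding gauss_mean_def by (subst Bochner_Integration.integral_diff[OF i1 i2]) simp
    also have "\<dots> = (\<integral>w. complex_of_real (gauss w) * (g (x + s k *\<^sub>R w) - g x) \<partial>lborel)"
      by (simp add: algebra_simps)
    finally have "ennreal (cmod (gauss_mean (s k) g x - g x)) \<le>
        (\<integral>\<^sup>+w. ennreal (cmod (complex_of_real (gauss w) * (g (x + s k *\<^sub>R w) - g x))) \<partial>lborel)"
      using integral_norm_bound_ennreal[OF Bochner_Integration.integrable_diff[OF i1 i2]]
      by (simp add: right_diff_distrib)
    \<comment> \<open>Split the weight evenly, so that Cauchy--Schwarz leaves the total mass 1 as one factor.\<close>
    also have "\<dots> = (\<integral>\<^sup>+w. ennreal (sqrt (gauss w)) * ennreal (sqrt (gauss w) * ?D w) \<partial>lborel)"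
      by (simp add: norm_mult ennreal_mult[symmetric] mult.assoc[symmetric])
    finally have "(ennreal (cmod (gauss_mean (s k) g x - g x)))\<^sup>2 \<le>
       (\<integral>\<^sup>+w. ennreal (sqrt (gauss w)) * ennreal (sqrt (gauss w) * ?D w) \<partial>lborel)\<^sup>2"
      by (rule power_mono_ennreal)
    also have "\<dots> \<le> (\<integral>\<^sup>+w. (ennreal (sqrt (gauss w)))\<^sup>2 \<partial>(lborel :: (real^'n) measure)) * (\<integral>\<^sup>+w. (ennreal (sqrt (gauss w) * ?D w))\<^sup>2 \<partial>lborel)"
      by (rule Cauchy_Schwarz_nn_integral) measurable
    also have "\<dots> = (\<integral>\<^sup>+w. ennreal (gauss w) * ennreal ((?D w)\<^sup>2) \<partial>lborel)"
      by (simp add: ennreal_power nn_integral_gauss power_mult_distrib ennreal_mult)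
    finally show ?thesis by (simp add: ennreal_power)
  qed
  have le: "(\<integral>\<^sup>+x. ennreal ((cmod (gauss_mean (s k) g x - g x))\<^sup>2) \<partial>lborel) \<le> (\<integral>\<^sup>+w. ennreal (gauss w) * \<omega> (s k *\<^sub>R w) \<partial>lborel)" for k
  proof -
    have "(\<integral>\<^sup>+x. ennreal ((cmod (gauss_mean (s k) g x - g x))\<^sup>2) \<partial>lborel) \<le>
      (\<integral>\<^sup>+x. \<integral>\<^sup>+w. ennreal (gauss w) * ennreal ((cmod (g (x + s k *\<^sub>R w) - g x))\<^sup>2) \<partial>lborel \<partial>lborel)"
      by (intro nn_integral_mono pointwise)
    also have "\<dots> = (\<integral>\<^sup>+w. \<integral>\<^sup>+x. ennreal (gauss w) * ennreal ((cmod (g (x + s k *\<^sub>R w) - g x))\<^sup>2) \<partial>lborel \<partial>lborel)"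
      by (rule lborel_pair.Fubini') measurable
    also have "\<dots> = (\<integral>\<^sup>+w. ennreal (gauss w) * \<omega> (s k *\<^sub>R w) \<partial>lborel)"
      unfolding \<omega>_def by (intro nn_integral_cong nn_integral_cmult) measurable
    finally show ?thesis .
  qed
  have "(\<lambda>k. \<integral>\<^sup>+w. ennreal (gauss w) * \<omega> (s k *\<^sub>R w) \<partial>lborel) \<longlonglongrightarrow> (\<integral>\<^sup>+w. 0 \<partial>(lborel :: (real^'n) measure))"
  proof (rule nn_integral_dominated_convergence[where w = "\<lambda>w. ennreal (gauss w) * (4 * E)"])
    show "(\<integral>\<^sup>+w. ennreal (gauss w) * (4 * E) \<partial>(lborel :: (real^'n) measure)) < \<infinity>"
      using E by (subst nn_integral_multc) (auto simp: nn_integral_gauss ennreal_mult_less_top)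
    show "AE w in lborel. (\<lambda>k. ennreal (gauss w) * \<omega> (s k *\<^sub>R w)) \<longlonglongrightarrow> 0"
    proof (rule AE_I2)
      fix w :: "real ^ 'n"
      have "(\<lambda>k. s k *\<^sub>R w) \<longlonglongrightarrow> 0 *\<^sub>R w" by (intro tendsto_intros s)
      then have "(\<lambda>k. \<omega> (s k *\<^sub>R w)) \<longlonglongrightarrow> 0"
        unfolding \<omega>_def by (intro L2_translation_continuous[OF g gb]) simp
      then have "(\<lambda>k. ennreal (gauss w) * \<omega> (s k *\<^sub>R w)) \<longlonglongrightarrow> ennreal (gauss w) * 0"
        by (intro ennreal_tendsto_cmult) auto
      then show "(\<lambda>k. ennreal (gauss w) * \<omega> (s k *\<^sub>R w)) \<longlonglongrightarrow> 0" by simp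
    qed
    show "AE w in lborel. ennreal (gauss w) * \<omega> (s k *\<^sub>R w) \<le> ennreal (gauss w) * (4 * E)" for k
      by (intro AE_I2 mult_left_mono \<omega>_le) auto
  qed measurable
  then have "(\<lambda>k. \<integral>\<^sup>+w. ennreal (gauss w) * \<omega> (s k *\<^sub>R w) \<partial>lborel) \<longlonglongrightarrow> 0" by simp
  then have "(\<lambda>k. \<integral>\<^sup>+x. ennreal ((cmod (gauss_mean (s k) g x - g x))\<^sup>2) \<partial>lborel) \<longlonglongrightarrow> 0"
    using le by (rule tendsto_0_le_ennreal[rotated])
  then show ?thesis by (rule L2_norm_tendsto_0I)
qed

section \<open>Gaussian summation of the inversion integral\<close>

text \<open>Integrals over product spaces require Borel functions, while elements of \<open>L2\<close> are only
  Lebesgue measurable; this lemma mediates.\<close>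

lemma borel_representative:
  fixes g :: "'a::euclidean_space \<Rightarrow> complex"
  assumes [measurable]: "g \<in> borel_measurable lebesgue"
  obtains g' where "g' \<in> borel_measurable borel" "AE x in lebesgue. g x = g' x"
proof -
  have "(\<lambda>x. Re (g x)) \<in> borel_measurable lebesgue" "(\<lambda>x. Im (g x)) \<in> borel_measurable lebesgue"
    by measurable
  then obtain a b where ab: "a \<in> borel_measurable lborel" "AE x in lborel. Re (g x) = a x"
      "b \<in> borel_measurable lborel" "AE x in lborel. Im (g x) = b x"
    using completion_ex_borel_measurable_real by metis
  have "AE x in lebesgue. g x = Complex (a x) (b x)"
    using ab(2,4) unfolding AE_completion_iff by eventually_elim (simp add: complex_eq_iff)
  moreover have "(\<lambda>x. Complex (a x) (b x)) \<in> borel_measurable borel"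
    using ab(1,3) by (subst borel_measurable_complex_iff) simp
  ultimately show ?thesis using that by blast
qed

lemma fourier_integral_cong_AE:
  assumes "g \<in> borel_measurable lebesgue" "h \<in> borel_measurable lebesgue" "AE x in lebesgue. g x = h x"
  shows "fourier_integral g = fourier_integral h"
proof
  note [measurable] = assms(1,2) borel_measurable_lebesgue_ident
  fix \<xi>
  have "(\<integral>x. exp (- \<i> * complex_of_real (\<xi> \<bullet> x)) * g x \<partial>lebesgue) = (\<integral>x. exp (- \<i> * complex_of_real (\<xi> \<bullet> x)) * h x \<partial>lebesgue)"
    by (rule integral_cong_AE) (use assms(3) in auto)
  then show "fourier_integral g \<xi> = fourier_integral h \<xi>" by (simp add: fourier_integral_def)
qed

lemma fourier_integral_borel:
  fixes g :: "real ^ 'n \<Rightarrow> complex"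
  assumes [measurable]: "g \<in> borel_measurable borel"
  shows "fourier_integral g \<xi> = complex_of_real ((2 * pi) powr (- real CARD('n) / 2)) *
     (\<integral>x. exp (- \<i> * complex_of_real (\<xi> \<bullet> x)) * g x \<partial>lborel)"
  unfolding fourier_integral_def by (subst integral_completion) auto

lemma fourier_integral_measurable [measurable]:
  fixes g :: "real ^ 'n \<Rightarrow> complex"
  assumes [measurable]: "g \<in> borel_measurable borel"
  shows "fourier_integral g \<in> borel_measurable borel"
  unfolding fourier_integral_borel[OF assms] by measurable

lemma norm_exp_i_times_inner [simp]:
  "cmod (exp (\<i> * complex_of_real t)) = 1" "cmod (exp (- (\<i> * complex_of_real t))) = 1"
  using norm_exp_i_times[of "- t"] by (simp_all)

lemma fourier_integral_bounded:
  fixes g :: "real ^ 'n \<Rightarrow> complex"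
  assumes g: "integrable lborel g"
  obtains B where "B \<ge> 0" "\<And>\<xi>. cmod (fourier_integral g \<xi>) \<le> B"
proof -
  have gb: "g \<in> borel_measurable borel" using borel_measurable_integrable[OF g] by simp
  define B where "B = (2 * pi) powr (- real CARD('n) / 2) * (\<integral>x. cmod (g x) \<partial>lborel)"
  have "cmod (fourier_integral g \<xi>) \<le> B" for \<xi>
  proof -
    have "cmod (\<integral>x. exp (- \<i> * complex_of_real (\<xi> \<bullet> x)) * g x \<partial>lborel) \<le>
       (\<integral>x. cmod (exp (- \<i> * complex_of_real (\<xi> \<bullet> x)) * g x) \<partial>lborel)"
      by (rule integral_norm_bound)
    also have "\<dots> = (\<integral>x. cmod (g x) \<partial>lborel)" by (simp add: norm_mult)
    finally show ?thesis
      unfolding fourier_integral_borel[OF gb] B_def by (simp add: norm_mult mult_left_mono)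
  qed
  moreover have "B \<ge> 0" unfolding B_def by simp
  ultimately show ?thesis using that by blast
qed

lemma borel_measurable_cnj [measurable]: "cnj \<in> borel_measurable borel"
  by (intro borel_measurable_continuous_onI continuous_intros)

lemma integrable_lborel_pair_mult:
  fixes f g :: "'a::euclidean_space \<Rightarrow> complex"
  assumes f: "integrable lborel f" and g: "integrable lborel g"
  shows "integrable (lborel \<Otimes>\<^sub>M lborel) (\<lambda>z. f (fst z) * g (snd z))"
proof (rule integrableI_bounded)
  have [measurable]: "f \<in> borel_measurable borel" "g \<in> borel_measurable borel"
    using borel_measurable_integrable[OF f] borel_measurable_integrable[OF g] by simp_all
  show "(\<lambda>z. f (fst z) * g (snd z)) \<in> borel_measurable (lborel \<Otimes>\<^sub>M lborel)" by measurable
  have "(\<integral>\<^sup>+z. ennreal (norm (f (fst z) * g (snd z))) \<partial>(lborel \<Otimes>\<^sub>M lborel)) =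
     (\<integral>\<^sup>+x. \<integral>\<^sup>+y. ennreal (norm (f x)) * ennreal (norm (g y)) \<partial>lborel \<partial>lborel)"
    by (subst lborel.nn_integral_fst[symmetric]) (auto simp: norm_mult ennreal_mult)
  also have "\<dots> = (\<integral>\<^sup>+x. ennreal (norm (f x)) \<partial>lborel) * (\<integral>\<^sup>+y. ennreal (norm (g y)) \<partial>lborel)"
    by (simp add: nn_integral_cmult nn_integral_multc)
  also have "\<dots> < \<infinity>"
    using f g by (simp add: integrable_iff_bounded ennreal_mult_less_top)
  finally show "(\<integral>\<^sup>+z. ennreal (norm (f (fst z) * g (snd z))) \<partial>(lborel \<Otimes>\<^sub>M lborel)) < \<infinity>" .
qed

lemma integrable_gauss_scaled:
  assumes "s \<noteq> 0"
  shows "integrable lborel (\<lambda>\<xi> :: real ^ 'n. complex_of_real (gauss (s *\<^sub>R \<xi>)))"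
  using lborel_integrable_affine[OF integrable_gauss assms, of 0] by (simp add: complex_of_real_integrable_eq)

text \<open>The Fourier transform of a rescaled Gaussian. The Jacobian is kept on the left to avoid a
  division.\<close>

lemma integral_cis_gauss_scaled:
  fixes v :: "real ^ 'n"
  assumes s: "s > 0"
  shows "complex_of_real (s ^ CARD('n)) * (\<integral>\<xi>. exp (\<i> * complex_of_real (\<xi> \<bullet> v)) * complex_of_real (gauss (s *\<^sub>R \<xi>)) \<partial>lborel)
     = complex_of_real (exp (- (norm (v /\<^sub>R s))\<^sup>2 / 2))"
proof -
  have e: "(v /\<^sub>R s) \<bullet> (s *\<^sub>R \<xi>) = \<xi> \<bullet> v" for \<xi>
    using s by (simp add: inner_commute)
  have "complex_of_real (exp (- (norm (v /\<^sub>R s))\<^sup>2 / 2)) =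
     (\<integral>\<xi>. exp (\<i> * complex_of_real ((v /\<^sub>R s) \<bullet> \<xi>)) * complex_of_real (gauss \<xi>) \<partial>lborel)"
    by (rule integral_gauss_cis[symmetric])
  also have "\<dots> = \<bar>s\<bar> ^ DIM(real^'n) *\<^sub>R (\<integral>\<xi>. exp (\<i> * complex_of_real ((v /\<^sub>R s) \<bullet> (0 + s *\<^sub>R \<xi>))) * complex_of_real (gauss (0 + s *\<^sub>R \<xi>)) \<partial>lborel)"
    by (rule lborel_integral_affine) (use s in \<open>auto\<close>)
  also have "\<dots> = complex_of_real (s ^ CARD('n)) * (\<integral>\<xi>. exp (\<i> * complex_of_real (\<xi> \<bullet> v)) * complex_of_real (gauss (s *\<^sub>R \<xi>)) \<partial>lborel)"
    using e by (simp add: scaleR_conv_of_real[where 'a = complex] del: inner_scaleR_left inner_scaleR_right) (use s in simp)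
  finally show ?thesis ..
qed

text \<open>Insert the definition of the transform, exchange the integrals (the Gaussian makes
  the integrand absolutely integrable), and compute the integral over \<open>\<xi>\<close>: it is a Gaussian centred
  at \<open>x\<close> with width \<open>s\<close>. The substitution \<open>y = x + s w\<close> gives the mean. The factor
  \<open>gauss (s \<xi>)\<close> already contains the constant \<open>(2 \<pi>) powr (-n/2)\<close> of the inverse transform.\<close>

lemma gauss_summed_inversion:
  fixes g :: "real ^ 'n \<Rightarrow> complex"
  assumes g: "integrable lborel g" and s: "s > 0"
  shows "(\<integral>\<xi>. exp (\<i> * complex_of_real (\<xi> \<bullet> x)) * fourier_integral g \<xi> * complex_of_real (gauss (s *\<^sub>R \<xi>)) \<partial>lborel)
     = gauss_mean s g x"
proof -
  have gb [measurable]: "g \<in> borel_measurable borel" using borel_measurable_integrable[OF g] by simp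
  define c where "c = (2 * pi) powr (- real CARD('n) / 2)"
  let ?K = "\<lambda>\<xi> y. exp (\<i> * complex_of_real (\<xi> \<bullet> x)) * exp (- \<i> * complex_of_real (\<xi> \<bullet> y)) *
     (complex_of_real (gauss (s *\<^sub>R \<xi>)) * g y)"
  have int: "integrable (lborel \<Otimes>\<^sub>M lborel) (case_prod ?K)"
    by (rule Bochner_Integration.integrable_bound[OF integrable_lborel_pair_mult[OF integrable_gauss_scaled[of s] g]])
       (use s in \<open>auto simp: norm_mult\<close>)
  have inner: "(\<integral>\<xi>. ?K \<xi> y \<partial>lborel) = complex_of_real (exp (- (norm ((x - y) /\<^sub>R s))\<^sup>2 / 2) / s ^ CARD('n)) * g y" for y
  proof -
    have "(\<integral>\<xi>. ?K \<xi> y \<partial>lborel) = (\<integral>\<xi>. (exp (\<i> * complex_of_real (\<xi> \<bullet> (x - y))) * complex_of_real (gauss (s *\<^sub>R \<xi>))) * g y \<partial>lborel)"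
      by (simp add: exp_add[symmetric] inner_diff_right right_diff_distrib mult.assoc[symmetric])
    also have "\<dots> = (\<integral>\<xi>. exp (\<i> * complex_of_real (\<xi> \<bullet> (x - y))) * complex_of_real (gauss (s *\<^sub>R \<xi>)) \<partial>lborel) * g y"
      by simp
    also have "(\<integral>\<xi>. exp (\<i> * complex_of_real (\<xi> \<bullet> (x - y))) * complex_of_real (gauss (s *\<^sub>R \<xi>)) \<partial>lborel)
        = complex_of_real (exp (- (norm ((x - y) /\<^sub>R s))\<^sup>2 / 2) / s ^ CARD('n))"
      using integral_cis_gauss_scaled[OF s, of "x - y"] s by (simp add: field_simps)
    finally show ?thesis .
  qed
  have "(\<integral>\<xi>. exp (\<i> * complex_of_real (\<xi> \<bullet> x)) * fourier_integral g \<xi> * complex_of_real (gauss (s *\<^sub>R \<xi>)) \<partial>lborel)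
     = (\<integral>\<xi>. complex_of_real c * (\<integral>y. ?K \<xi> y \<partial>lborel) \<partial>lborel)"
  proof (rule Bochner_Integration.integral_cong[OF refl])
    fix \<xi>
    have "(\<integral>y. ?K \<xi> y \<partial>lborel) = (\<integral>y. (exp (\<i> * complex_of_real (\<xi> \<bullet> x)) * complex_of_real (gauss (s *\<^sub>R \<xi>))) * (exp (- \<i> * complex_of_real (\<xi> \<bullet> y)) * g y) \<partial>lborel)"
      by (simp add: mult_ac)
    also have "\<dots> = (exp (\<i> * complex_of_real (\<xi> \<bullet> x)) * complex_of_real (gauss (s *\<^sub>R \<xi>))) * (\<integral>y. exp (- \<i> * complex_of_real (\<xi> \<bullet> y)) * g y \<partial>lborel)"
      by simp
    finally show "exp (\<i> * complex_of_real (\<xi> \<bullet> x)) * fourier_integral g \<xi> * complex_of_real (gauss (s *\<^sub>R \<xi>)) = complex_of_real c * (\<integral>y. ?K \<xi> y \<partial>lborel)"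
      unfolding fourier_integral_borel[OF gb] c_def by simp
  qed
  also have "\<dots> = complex_of_real c * (\<integral>\<xi>. (\<integral>y. ?K \<xi> y \<partial>lborel) \<partial>lborel)" by simp
  also have "(\<integral>\<xi>. (\<integral>y. ?K \<xi> y \<partial>lborel) \<partial>lborel) = (\<integral>y. complex_of_real (exp (- (norm ((x - y) /\<^sub>R s))\<^sup>2 / 2) / s ^ CARD('n)) * g y \<partial>lborel)"
    unfolding inner[symmetric] by (rule lborel_pair.Fubini_integral[OF int, symmetric])
  also have "complex_of_real c * (\<integral>y. complex_of_real (exp (- (norm ((x - y) /\<^sub>R s))\<^sup>2 / 2) / s ^ CARD('n)) * g y \<partial>lborel)
     = (\<integral>y. complex_of_real c * (complex_of_real (exp (- (norm ((x - y) /\<^sub>R s))\<^sup>2 / 2) / s ^ CARD('n)) * g y) \<partial>lborel)"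
    by simp
  also have "\<dots> = (\<integral>y. complex_of_real (gauss ((y - x) /\<^sub>R s) / s ^ CARD('n)) * g y \<partial>lborel)"
    by (simp add: gauss_def c_def norm_minus_commute[of x] mult.assoc)
  also have "\<dots> = \<bar>s\<bar> ^ DIM(real^'n) *\<^sub>R (\<integral>w. complex_of_real (gauss ((x + s *\<^sub>R w - x) /\<^sub>R s) / s ^ CARD('n)) * g (x + s *\<^sub>R w) \<partial>lborel)"
    by (rule lborel_integral_affine) (use s in auto)
  also have "\<dots> = complex_of_real (s ^ CARD('n)) * (\<integral>w. (complex_of_real (gauss w) * g (x + s *\<^sub>R w)) / complex_of_real (s ^ CARD('n)) \<partial>lborel)"
    using s by (simp add: scaleR_conv_of_real[where 'a = complex])
  also have "\<dots> = gauss_mean s g x"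
    using s by (simp add: gauss_mean_def)
  finally show ?thesis .
qed

text \<open>Parseval's identity with a Gaussian weight: write one of the two factors
  \<open>fourier_integral g\<close> as an integral and exchange the integrals; the inner one is then the
  conjugate of the Gaussian-summed inversion integral.\<close>

lemma
  fixes g :: "real ^ 'n \<Rightarrow> complex"
  assumes g: "integrable lborel g" and s: "s > 0"
  shows gauss_parseval_integrable: "integrable lborel (\<lambda>y. g y * cnj (gauss_mean s g y))"
    and gauss_parseval: "(\<integral>\<xi>. complex_of_real ((cmod (fourier_integral g \<xi>))\<^sup>2 * exp (- (norm (s *\<^sub>R \<xi>))\<^sup>2 / 2)) \<partial>lborel)
     = (\<integral>y. g y * cnj (gauss_mean s g y) \<partial>lborel)"
proof -
  have gb [measurable]: "g \<in> borel_measurable borel" using borel_measurable_integrable[OF g] by simp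
  define c where "c = (2 * pi) powr (- real CARD('n) / 2)"
  obtain B where B: "B \<ge> 0" "\<And>\<xi>. cmod (fourier_integral g \<xi>) \<le> B"
    using fourier_integral_bounded[OF g] by blast
  let ?K = "\<lambda>\<xi> y. cnj (fourier_integral g \<xi>) * exp (- \<i> * complex_of_real (\<xi> \<bullet> y)) *
     (complex_of_real (gauss (s *\<^sub>R \<xi>)) * g y)"
  have int: "integrable (lborel \<Otimes>\<^sub>M lborel) (case_prod ?K)"
  proof (rule Bochner_Integration.integrable_bound[OF integrable_mult_right[OF integrable_lborel_pair_mult[OF integrable_gauss_scaled[of s] g], of "complex_of_real B"]])
    show "AE z in lborel \<Otimes>\<^sub>M lborel. norm (case_prod ?K z) \<le> norm (complex_of_real B * (complex_of_real (gauss (s *\<^sub>R fst z)) * g (snd z)))"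
      using B by (intro AE_I2) (auto simp: norm_mult intro!: mult_right_mono)
  qed (use s in auto)
  have cnj_exp: "cnj (exp (\<i> * complex_of_real t)) = exp (- \<i> * complex_of_real t)" for t
    by (simp add: exp_cnj)
  have inner: "(\<integral>\<xi>. ?K \<xi> y \<partial>lborel) = g y * cnj (gauss_mean s g y)" for y
  proof -
    have "(\<integral>\<xi>. ?K \<xi> y \<partial>lborel) = (\<integral>\<xi>. cnj (exp (\<i> * complex_of_real (\<xi> \<bullet> y)) * fourier_integral g \<xi> * complex_of_real (gauss (s *\<^sub>R \<xi>))) * g y \<partial>lborel)"
      by (simp add: cnj_exp mult_ac)
    also have "\<dots> = cnj (gauss_mean s g y) * g y"
      unfolding gauss_summed_inversion[OF g s, symmetric] integral_mult_left_zero
      by (simp only: Bochner_Integration.integral_cnj)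
    finally show ?thesis by (simp add: mult.commute)
  qed
  show "integrable lborel (\<lambda>y. g y * cnj (gauss_mean s g y))"
    using lborel_pair.integrable_snd[OF int] unfolding inner .
  have "(\<integral>\<xi>. complex_of_real ((cmod (fourier_integral g \<xi>))\<^sup>2 * exp (- (norm (s *\<^sub>R \<xi>))\<^sup>2 / 2)) \<partial>lborel)
    = (\<integral>\<xi>. (\<integral>y. ?K \<xi> y \<partial>lborel) \<partial>lborel)"
  proof (rule Bochner_Integration.integral_cong[OF refl])
    fix \<xi>
    have "(\<integral>y. ?K \<xi> y \<partial>lborel) = (\<integral>y. (cnj (fourier_integral g \<xi>) * complex_of_real (gauss (s *\<^sub>R \<xi>))) * (exp (- \<i> * complex_of_real (\<xi> \<bullet> y)) * g y) \<partial>lborel)"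
      by (simp add: mult_ac)
    also have "\<dots> = (cnj (fourier_integral g \<xi>) * complex_of_real (gauss (s *\<^sub>R \<xi>))) * (\<integral>y. exp (- \<i> * complex_of_real (\<xi> \<bullet> y)) * g y \<partial>lborel)"
      by simp
    also have "\<dots> = cnj (fourier_integral g \<xi>) * complex_of_real (exp (- (norm (s *\<^sub>R \<xi>))\<^sup>2 / 2)) * fourier_integral g \<xi>"
      unfolding fourier_integral_borel[OF gb] gauss_def by simp
    finally show "complex_of_real ((cmod (fourier_integral g \<xi>))\<^sup>2 * exp (- (norm (s *\<^sub>R \<xi>))\<^sup>2 / 2)) = (\<integral>y. ?K \<xi> y \<partial>lborel)"
      by (simp only: complex_norm_square of_real_mult mult_ac)
  qed
  also have "\<dots> = (\<integral>y. (\<integral>\<xi>. ?K \<xi> y \<partial>lborel) \<partial>lborel)"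
    by (rule lborel_pair.Fubini_integral[OF int, symmetric])
  finally show "(\<integral>\<xi>. complex_of_real ((cmod (fourier_integral g \<xi>))\<^sup>2 * exp (- (norm (s *\<^sub>R \<xi>))\<^sup>2 / 2)) \<partial>lborel)
     = (\<integral>y. g y * cnj (gauss_mean s g y) \<partial>lborel)" unfolding inner .
qed

section \<open>Plancherel's theorem\<close>

lemma nn_integral_cmod_mult_le:
  fixes g h :: "real ^ 'n \<Rightarrow> complex"
  assumes [measurable]: "g \<in> borel_measurable borel" "h \<in> borel_measurable borel"
  shows "(\<integral>\<^sup>+x. ennreal (cmod (g x * h x)) \<partial>lborel) \<le> L2_norm g * L2_norm h"
proof -
  have "(\<integral>\<^sup>+x. ennreal (cmod (g x * h x)) \<partial>lborel)\<^sup>2 \<le> (L2_norm g * L2_norm h)\<^sup>2"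
    using Cauchy_Schwarz_nn_integral[of "\<lambda>x. ennreal (cmod (g x))" lborel "\<lambda>x. ennreal (cmod (h x))"]
    by (simp add: L2_norm_power2 ennreal_power power_mult_distrib norm_mult ennreal_mult)
  then show ?thesis by (simp only: ennreal_power2_le_iff)
qed

text \<open>Let the width \<open>s k\<close> tend to 0 in the weighted Parseval identity. The left-hand side increases to the
  squared norm of the transform; on the right-hand side the Gaussian means converge to \<open>g\<close>
  in \<open>L2\<close>. The identity thus also proves that the transform is square integrable.\<close>

lemma L2_norm_fourier_integral_borel:
  fixes g :: "real ^ 'n \<Rightarrow> complex"
  assumes g: "integrable lborel g" and g2: "g \<in> L2"
  shows "L2_norm (fourier_integral g) = L2_norm g"
proof -
  have gb [measurable]: "g \<in> borel_measurable borel" using borel_measurable_integrable[OF g] by simp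
  define s where "s k = 1 / (real k + 1)" for k :: nat
  have s_pos: "s k > 0" for k by (simp add: s_def)
  have s_lim: "s \<longlonglongrightarrow> 0"
    unfolding s_def by (rule LIMSEQ_inverse_real_of_nat[unfolded inverse_eq_divide, simplified add.commute[of 1] of_nat_Suc])
  let ?T = "\<lambda>k. gauss_mean (s k) g"
  let ?w = "\<lambda>k \<xi>. (cmod (fourier_integral g \<xi>))\<^sup>2 * exp (- (norm (s k *\<^sub>R \<xi>))\<^sup>2 / 2)"
  define E where "E = (\<integral>y. (cmod (g y))\<^sup>2 \<partial>lborel)"
  have iE: "integrable lborel (\<lambda>y. (cmod (g y))\<^sup>2)"
    using L2_borel_nn_integral_finite[OF g2] by (intro integrableI_bounded) auto
  have iE': "integrable lborel (\<lambda>y. g y * cnj (g y))"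
    using iE by (simp add: complex_norm_square[symmetric] complex_of_real_integrable_eq flip: of_real_power)
  have E_eq: "complex_of_real E = (\<integral>y. g y * cnj (g y) \<partial>lborel)"
    unfolding E_def by (simp add: complex_norm_square[symmetric] flip: of_real_power integral_complex_of_real)
  have lim: "(\<lambda>k. \<integral>y. g y * cnj (?T k y) \<partial>lborel) \<longlonglongrightarrow> complex_of_real E"
  proof -
    have "ennreal (cmod ((\<integral>y. g y * cnj (?T k y) \<partial>lborel) - complex_of_real E)) \<le> L2_norm g * L2_norm (\<lambda>y. ?T k y - g y)" for k
    proof -
      have i: "integrable lborel (\<lambda>y. g y * cnj (?T k y))" by (rule gauss_parseval_integrable[OF g s_pos])
      have "(\<integral>y. g y * cnj (?T k y) \<partial>lborel) - complex_of_real E = (\<integral>y. g y * cnj (?T k y) - g y * cnj (g y) \<partial>lborel)"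
        unfolding E_eq by (rule Bochner_Integration.integral_diff[OF i iE', symmetric])
      then have "ennreal (cmod ((\<integral>y. g y * cnj (?T k y) \<partial>lborel) - complex_of_real E)) \<le>
          (\<integral>\<^sup>+y. ennreal (cmod (g y * cnj (?T k y) - g y * cnj (g y))) \<partial>lborel)"
        using integral_norm_bound_ennreal[OF Bochner_Integration.integrable_diff[OF i iE']] by simp
      also have "\<dots> = (\<integral>\<^sup>+y. ennreal (cmod (g y * (?T k y - g y))) \<partial>lborel)"
        by (intro nn_integral_cong) (simp add: norm_mult right_diff_distrib[symmetric] flip: complex_cnj_diff)
      also have "\<dots> \<le> L2_norm g * L2_norm (\<lambda>y. ?T k y - g y)"
        by (rule nn_integral_cmod_mult_le) measurable
      finally show ?thesis .
    qed
    moreover have "(\<lambda>k. L2_norm g * L2_norm (\<lambda>y. ?T k y - g y)) \<longlonglongrightarrow> L2_norm g * 0"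
    proof (rule ennreal_tendsto_cmult)
      show "L2_norm g < top" using g2 by (simp add: L2_def)
      show "(\<lambda>k. L2_norm (\<lambda>y. ?T k y - g y)) \<longlonglongrightarrow> 0"
        using s_pos by (intro gauss_mean_tendsto_L2[OF g g2 _ s_lim]) (metis less_irrefl)
    qed
    ultimately have "(\<lambda>k. ennreal (cmod ((\<integral>y. g y * cnj (?T k y) \<partial>lborel) - complex_of_real E))) \<longlonglongrightarrow> 0"
      by (metis (no_types, lifting) tendsto_0_le_ennreal mult_zero_right)
    then have "(\<lambda>k. cmod ((\<integral>y. g y * cnj (?T k y) \<partial>lborel) - complex_of_real E)) \<longlonglongrightarrow> 0"
      using tendsto_ennreal_iff[of "\<lambda>k. cmod ((\<integral>y. g y * cnj (?T k y) \<partial>lborel) - complex_of_real E)" sequentially 0] by simp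
    then show ?thesis using Lim_null tendsto_norm_zero_iff by blast
  qed
  have "(\<lambda>k. complex_of_real (\<integral>\<xi>. ?w k \<xi> \<partial>lborel)) \<longlonglongrightarrow> complex_of_real E"
    using lim unfolding gauss_parseval[OF g s_pos, symmetric] integral_complex_of_real .
  then have lim_w: "(\<lambda>k. \<integral>\<xi>. ?w k \<xi> \<partial>lborel) \<longlonglongrightarrow> E" by (simp only: tendsto_of_real_iff)
  obtain B where B: "B \<ge> 0" "\<And>\<xi>. cmod (fourier_integral g \<xi>) \<le> B"
    using fourier_integral_bounded[OF g] by blast
  have int_w: "integrable lborel (?w k)" for k
  proof -
    have "integrable lborel (\<lambda>\<xi>::real^'n. gauss (s k *\<^sub>R \<xi>))"
      using lborel_integrable_affine[OF integrable_gauss, of "s k" 0] s_pos[of k] by simp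
    then have "integrable lborel (\<lambda>\<xi>::real^'n. B\<^sup>2 * ((2 * pi) powr (real CARD('n) / 2) * gauss (s k *\<^sub>R \<xi>)))" by simp
    moreover have "(2 * pi) powr (real CARD('n) / 2) * gauss \<xi> = exp (- (norm \<xi>)\<^sup>2 / 2)" for \<xi> :: "real^'n"
      by (simp add: gauss_def powr_minus)
    ultimately have "integrable lborel (\<lambda>\<xi>::real^'n. B\<^sup>2 * exp (- (norm (s k *\<^sub>R \<xi>))\<^sup>2 / 2))" by (simp only:)
    then show ?thesis
      by (rule Bochner_Integration.integrable_bound) (auto simp: abs_mult intro!: mult_right_mono power_mono B)
  qed
  have "(\<lambda>k. \<integral>\<^sup>+\<xi>. ennreal (?w k \<xi>) \<partial>lborel) \<longlonglongrightarrow> (\<integral>\<^sup>+\<xi>. ennreal ((cmod (fourier_integral g \<xi>))\<^sup>2) \<partial>lborel)"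
  proof (rule nn_integral_LIMSEQ)
    show "incseq (\<lambda>k \<xi>. ennreal (?w k \<xi>))"
    proof (intro incseq_SucI le_funI ennreal_leI mult_left_mono)
      fix k and \<xi> :: "real ^ 'n"
      have "norm (s (Suc k) *\<^sub>R \<xi>) \<le> norm (s k *\<^sub>R \<xi>)"
        using s_pos[of k] s_pos[of "Suc k"] by (simp add: s_def frac_le mult_right_mono)
      then show "exp (- (norm (s k *\<^sub>R \<xi>))\<^sup>2 / 2) \<le> exp (- (norm (s (Suc k) *\<^sub>R \<xi>))\<^sup>2 / 2)"
        by (simp del: norm_scaleR add: power_mono)
    qed simp
    fix \<xi> :: "real ^ 'n"
    have "(\<lambda>k. ?w k \<xi>) \<longlonglongrightarrow> (cmod (fourier_integral g \<xi>))\<^sup>2 * exp (- (norm (0 *\<^sub>R \<xi>))\<^sup>2 / 2)"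
      by (intro tendsto_intros s_lim) simp
    then show "(\<lambda>k. ennreal (?w k \<xi>)) \<longlonglongrightarrow> ennreal ((cmod (fourier_integral g \<xi>))\<^sup>2)"
      by (intro tendsto_ennrealI) simp
  qed measurable
  moreover have "(\<integral>\<^sup>+\<xi>. ennreal (?w k \<xi>) \<partial>lborel) = ennreal (\<integral>\<xi>. ?w k \<xi> \<partial>lborel)" for k
    by (rule nn_integral_eq_integral[OF int_w]) simp
  ultimately have "(\<integral>\<^sup>+\<xi>. ennreal ((cmod (fourier_integral g \<xi>))\<^sup>2) \<partial>lborel) = ennreal E"
    using LIMSEQ_unique tendsto_ennrealI[OF lim_w] by fastforce
  also have "\<dots> = (\<integral>\<^sup>+y. ennreal ((cmod (g y))\<^sup>2) \<partial>lborel)"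
    unfolding E_def by (rule nn_integral_eq_integral[OF iE, symmetric]) simp
  finally show ?thesis by (simp add: L2_norm_def nn_integral_completion)
qed

lemma L1_L2_borel_representative:
  fixes g :: "real ^ 'n \<Rightarrow> complex"
  assumes g: "g \<in> L1 \<inter> L2"
  obtains g' where "g' \<in> borel_measurable borel" "integrable lborel g'" "g' \<in> L2"
    "AE x in lebesgue. g x = g' x" "fourier_integral g = fourier_integral g'" "L2_norm g = L2_norm g'"
proof -
  have gm: "g \<in> borel_measurable lebesgue" using g by (simp add: L2_def)
  obtain g' where g': "g' \<in> borel_measurable borel" "AE x in lebesgue. g x = g' x"
    using borel_representative[OF gm] by blast
  have g'm: "g' \<in> borel_measurable lebesgue" using g'(1) by (intro measurable_completion) simp
  have "integrable lebesgue g'"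
    using g g' g'm gm by (subst integrable_cong_AE[of _ _ g]) (auto simp: L1_def eq_commute)
  then have "integrable lborel g'" using g'(1) by (simp add: integrable_completion)
  moreover have n: "L2_norm g = L2_norm g'" by (rule L2_norm_cong_AE[OF g'(2)])
  moreover have "g' \<in> L2" using g g'm n by (simp add: L2_def)
  ultimately show ?thesis using that g' fourier_integral_cong_AE[OF gm g'm g'(2)] by blast
qed

lemma fourier_integral_L2:
  fixes g :: "real ^ 'n \<Rightarrow> complex"
  assumes g: "g \<in> L1 \<inter> L2"
  shows "L2_norm (fourier_integral g) = L2_norm g" and "fourier_integral g \<in> L2"
proof -
  obtain g' where g': "g' \<in> borel_measurable borel" "integrable lborel g'" "g' \<in> L2"
    "fourier_integral g = fourier_integral g'" "L2_norm g = L2_norm g'"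
    using L1_L2_borel_representative[OF g] by metis
  show *: "L2_norm (fourier_integral g) = L2_norm g"
    using g' L2_norm_fourier_integral_borel[of g'] by simp
  have "fourier_integral g' \<in> borel_measurable lebesgue"
    using g'(1) by (intro measurable_completion) simp
  then show "fourier_integral g \<in> L2" using g * g'(4) by (simp add: L2_def)
qed

lemma fourier_integral_diff:
  fixes g h :: "real ^ 'n \<Rightarrow> complex"
  assumes g: "g \<in> L1 \<inter> L2" and h: "h \<in> L1 \<inter> L2"
  shows "fourier_integral (\<lambda>x. g x - h x) \<xi> = fourier_integral g \<xi> - fourier_integral h \<xi>"
proof -
  have i: "integrable lebesgue (\<lambda>x. exp (- \<i> * complex_of_real (\<xi> \<bullet> x)) * k x)" if "k \<in> L1 \<inter> L2" for k :: "real ^ 'n \<Rightarrow> complex"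
  proof -
    note [measurable] = borel_measurable_lebesgue_ident
    have [measurable]: "k \<in> borel_measurable lebesgue" and k: "integrable lebesgue k" using that by (auto simp: L1_def L2_def)
    show ?thesis by (rule Bochner_Integration.integrable_bound[OF k]) (auto simp: norm_mult)
  qed
  show ?thesis
    unfolding fourier_integral_def right_diff_distrib[of "exp _"] Bochner_Integration.integral_diff[OF i[OF g] i[OF h]]
    by (simp add: right_diff_distrib)
qed

lemma has_fourierD:
  assumes "has_fourier g G"
  shows "g \<in> L2" "G \<in> L2"
  using assms by (auto simp: has_fourier_def)

lemma has_fourier_cong_AE:
  fixes g :: "real ^ 'n \<Rightarrow> complex"
  assumes "has_fourier g G" "G' \<in> L2" and ae: "AE x in lebesgue. G x = G' x"
  shows "has_fourier g G'"
proof -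
  have "L2_norm (\<lambda>\<xi>. F \<xi> - G \<xi>) = L2_norm (\<lambda>\<xi>. F \<xi> - G' \<xi>)" for F
    by (rule L2_norm_cong_AE) (use ae in auto)
  then show ?thesis using assms by (simp add: has_fourier_def)
qed

lemma has_fourier_diff:
  fixes g h :: "real ^ 'n \<Rightarrow> complex"
  assumes g: "has_fourier g G" and h: "has_fourier h H"
  shows "has_fourier (\<lambda>x. g x - h x) (\<lambda>\<xi>. G \<xi> - H \<xi>)"
proof -
  obtain a where a: "\<And>k. a k \<in> L1 \<inter> L2" "(\<lambda>k. L2_norm (\<lambda>x. a k x - g x)) \<longlonglongrightarrow> 0"
     "(\<lambda>k. L2_norm (\<lambda>\<xi>. fourier_integral (a k) \<xi> - G \<xi>)) \<longlonglongrightarrow> 0"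
    using g by (auto simp: has_fourier_def)
  obtain b where b: "\<And>k. b k \<in> L1 \<inter> L2" "(\<lambda>k. L2_norm (\<lambda>x. b k x - h x)) \<longlonglongrightarrow> 0"
     "(\<lambda>k. L2_norm (\<lambda>\<xi>. fourier_integral (b k) \<xi> - H \<xi>)) \<longlonglongrightarrow> 0"
    using h by (auto simp: has_fourier_def)
  have diff: "(\<lambda>k. L2_norm (\<lambda>x. (p k x - q k x) - (P x - Q x))) \<longlonglongrightarrow> 0"
    if "\<And>k. p k \<in> L2" "\<And>k. q k \<in> L2" "P \<in> L2" "Q \<in> L2"
      "(\<lambda>k. L2_norm (\<lambda>x. p k x - P x)) \<longlonglongrightarrow> 0" "(\<lambda>k. L2_norm (\<lambda>x. q k x - Q x)) \<longlonglongrightarrow> 0"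
    for p q :: "nat \<Rightarrow> real ^ 'n \<Rightarrow> complex" and P Q
  proof (rule tendsto_0_le_ennreal)
    note [measurable] = that(1-4)[THEN L2_measurable]
    show "L2_norm (\<lambda>x. (p k x - q k x) - (P x - Q x)) \<le> L2_norm (\<lambda>x. p k x - P x) + L2_norm (\<lambda>x. q k x - Q x)" for k
      using L2_norm_diff_le[of "\<lambda>x. p k x - P x" "\<lambda>x. q k x - Q x"] by (simp add: algebra_simps)
    show "(\<lambda>k. L2_norm (\<lambda>x. p k x - P x) + L2_norm (\<lambda>x. q k x - Q x)) \<longlonglongrightarrow> 0"
      using tendsto_add[OF that(5,6)] by simp
  qed
  note L2s = has_fourierD[OF g] has_fourierD[OF h]
  have "(\<lambda>x. a k x - b k x) \<in> L1 \<inter> L2" for k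
    using a(1)[of k] b(1)[of k] L2_diff[of "a k" "b k"] by (auto simp: L1_def)
  moreover have "(\<lambda>k. L2_norm (\<lambda>x. (a k x - b k x) - (g x - h x))) \<longlonglongrightarrow> 0"
    using a(1) b(1) by (intro diff a(2) b(2) L2s) auto
  moreover have "(\<lambda>k. L2_norm (\<lambda>\<xi>. fourier_integral (\<lambda>x. a k x - b k x) \<xi> - (G \<xi> - H \<xi>))) \<longlonglongrightarrow> 0"
    unfolding fourier_integral_diff[OF a(1) b(1)]
    by (intro diff a(3) b(3) L2s fourier_integral_L2 a(1) b(1))
  ultimately show ?thesis
    unfolding has_fourier_def
    by (intro conjI L2_diff L2s exI[of _ "\<lambda>k x. a k x - b k x"]) auto
qed

text \<open>Stated one-sidedly, so that using it in both directions gives equality of the norms of the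
  limits.\<close>

lemma L2_norm_limit_le:
  fixes p :: "nat \<Rightarrow> real ^ 'n \<Rightarrow> complex" and q :: "nat \<Rightarrow> real ^ 'n \<Rightarrow> complex"
  assumes "\<And>k. p k \<in> L2" "\<And>k. q k \<in> L2" "P \<in> L2" "Q \<in> L2" "\<And>k. L2_norm (p k) = L2_norm (q k)"
    and lim: "(\<lambda>k. L2_norm (\<lambda>x. p k x - P x)) \<longlonglongrightarrow> 0" "(\<lambda>k. L2_norm (\<lambda>x. q k x - Q x)) \<longlonglongrightarrow> 0"
  shows "L2_norm P \<le> L2_norm Q"
proof -
  note [measurable] = assms(1-4)[THEN L2_measurable]
  have "L2_norm P \<le> (L2_norm (\<lambda>x. p k x - P x) + L2_norm (\<lambda>x. q k x - Q x)) + L2_norm Q" for k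
  proof -
    have "L2_norm P \<le> L2_norm (\<lambda>x. p k x - P x) + L2_norm (p k)"
      using L2_norm_diff_le[of "p k" "\<lambda>x. p k x - P x"] by (simp add: add.commute)
    also have "L2_norm (p k) = L2_norm (\<lambda>x. (q k x - Q x) + Q x)" using assms(5) by simp
    also have "\<dots> \<le> L2_norm (\<lambda>x. q k x - Q x) + L2_norm Q" by (rule L2_norm_add_le) measurable
    finally show ?thesis by (simp add: add.assoc add_left_mono)
  qed
  moreover have "(\<lambda>k. (L2_norm (\<lambda>x. p k x - P x) + L2_norm (\<lambda>x. q k x - Q x)) + L2_norm Q) \<longlonglongrightarrow> (0 + 0) + L2_norm Q"
    by (intro tendsto_add lim tendsto_const)
  ultimately show ?thesis by (intro LIMSEQ_le_const[of _ "L2_norm Q"]) auto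
qed

lemma has_fourier_isometry:
  fixes g :: "real ^ 'n \<Rightarrow> complex"
  assumes g: "has_fourier g G"
  shows "L2_norm G = L2_norm g"
proof -
  obtain a where a: "\<And>k. a k \<in> L1 \<inter> L2" "(\<lambda>k. L2_norm (\<lambda>x. a k x - g x)) \<longlonglongrightarrow> 0"
     "(\<lambda>k. L2_norm (\<lambda>\<xi>. fourier_integral (a k) \<xi> - G \<xi>)) \<longlonglongrightarrow> 0"
    using g by (auto simp: has_fourier_def)
  show ?thesis
    using a(1) has_fourierD[OF g] fourier_integral_L2[OF a(1)]
    by (intro antisym L2_norm_limit_le[OF _ _ _ _ _ a(3) a(2)] L2_norm_limit_le[OF _ _ _ _ _ a(2) a(3)]) auto
qed

text \<open>The graph was defined as a sequential closure; a diagonal choice shows that it is closed.\<close>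

lemma has_fourier_closed:
  fixes g :: "nat \<Rightarrow> real ^ 'n \<Rightarrow> complex"
  assumes gG: "\<And>k. has_fourier (g k) (G k)" and h: "h \<in> L2" "H \<in> L2"
    and lim: "(\<lambda>k. L2_norm (\<lambda>x. g k x - h x)) \<longlonglongrightarrow> 0" "(\<lambda>k. L2_norm (\<lambda>x. G k x - H x)) \<longlonglongrightarrow> 0"
  shows "has_fourier h H"
proof -
  let ?e = "\<lambda>k::nat. ennreal (1 / (real k + 1))"
  have e: "?e \<longlonglongrightarrow> ennreal 0"
    by (intro tendsto_ennrealI LIMSEQ_inverse_real_of_nat[unfolded inverse_eq_divide, simplified add.commute[of 1] of_nat_Suc])
  have "\<exists>a. a \<in> L1 \<inter> L2 \<and> L2_norm (\<lambda>x. a x - g k x) < ?e k \<and> L2_norm (\<lambda>\<xi>. fourier_integral a \<xi> - G k \<xi>) < ?e k" for k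
  proof -
    obtain a where a: "\<And>k. a k \<in> L1 \<inter> L2" "(\<lambda>j. L2_norm (\<lambda>x. a j x - g k x)) \<longlonglongrightarrow> 0"
       "(\<lambda>j. L2_norm (\<lambda>\<xi>. fourier_integral (a j) \<xi> - G k \<xi>)) \<longlonglongrightarrow> 0"
      using gG[of k] by (auto simp: has_fourier_def)
    have "\<forall>\<^sub>F j in sequentially. L2_norm (\<lambda>x. a j x - g k x) < ?e k \<and> L2_norm (\<lambda>\<xi>. fourier_integral (a j) \<xi> - G k \<xi>) < ?e k"
      using order_tendstoD(2)[OF a(2), of "?e k"] order_tendstoD(2)[OF a(3), of "?e k"]
      by (intro eventually_conj) auto
    then show ?thesis using a(1) by (auto simp: eventually_sequentially)
  qed
  then obtain a where a: "\<And>k. a k \<in> L1 \<inter> L2" "\<And>k. L2_norm (\<lambda>x. a k x - g k x) < ?e k"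
    "\<And>k. L2_norm (\<lambda>\<xi>. fourier_integral (a k) \<xi> - G k \<xi>) < ?e k" by metis
  have conv: "(\<lambda>k. L2_norm (\<lambda>x. p k x - Q x)) \<longlonglongrightarrow> 0"
    if "\<And>k. p k \<in> L2" "\<And>k. q k \<in> L2" "Q \<in> L2" "\<And>k. L2_norm (\<lambda>x. p k x - q k x) < ?e k"
      "(\<lambda>k. L2_norm (\<lambda>x. q k x - Q x)) \<longlonglongrightarrow> 0"
    for p q :: "nat \<Rightarrow> real ^ 'n \<Rightarrow> complex" and Q
  proof (rule tendsto_0_le_ennreal)
    note [measurable] = that(1-3)[THEN L2_measurable]
    show "L2_norm (\<lambda>x. p k x - Q x) \<le> ?e k + L2_norm (\<lambda>x. q k x - Q x)" for k
    proof -
      have "L2_norm (\<lambda>x. p k x - Q x) \<le> L2_norm (\<lambda>x. p k x - q k x) + L2_norm (\<lambda>x. q k x - Q x)"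
        by (rule L2_norm_triangle) measurable
      also have "\<dots> \<le> ?e k + L2_norm (\<lambda>x. q k x - Q x)"
        using that(4)[of k] by (intro add_right_mono) simp
      finally show ?thesis .
    qed
    show "(\<lambda>k. ?e k + L2_norm (\<lambda>x. q k x - Q x)) \<longlonglongrightarrow> 0"
      using tendsto_add[OF e that(5)] by simp
  qed
  have "(\<lambda>k. L2_norm (\<lambda>x. a k x - h x)) \<longlonglongrightarrow> 0"
    using a(1) has_fourierD(1)[OF gG] by (intro conv[OF _ _ h(1) a(2) lim(1)]) auto
  moreover have "(\<lambda>k. L2_norm (\<lambda>\<xi>. fourier_integral (a k) \<xi> - H \<xi>)) \<longlonglongrightarrow> 0"
    using fourier_integral_L2[OF a(1)] has_fourierD(2)[OF gG] by (intro conv[OF _ _ h(2) a(3) lim(2)]) auto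
  ultimately show ?thesis unfolding has_fourier_def using h a(1) by blast
qed

lemma has_fourier_L1_L2:
  fixes g :: "real ^ 'n \<Rightarrow> complex"
  assumes "g \<in> L1 \<inter> L2"
  shows "has_fourier g (fourier_integral g)"
proof -
  have "L2_norm (\<lambda>x :: real ^ 'n. 0) = 0" by (simp add: L2_norm_def ennreal_sqrt_def)
  then show ?thesis
    unfolding has_fourier_def using assms fourier_integral_L2[OF assms] by (auto intro!: exI[of _ "\<lambda>_. g"])
qed

lemma L2_norm_reflect:
  fixes g :: "real ^ 'n \<Rightarrow> complex"
  assumes [measurable]: "g \<in> borel_measurable borel"
  shows "L2_norm (\<lambda>x. g (- x)) = L2_norm g"
proof -
  have "(lborel :: (real^'n) measure) = distr lborel borel (\<lambda>x. - x)"
    using lborel_affine[of "- 1" "0 :: real ^ 'n"] by (simp add: density_1)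
  then have "(\<integral>\<^sup>+x. ennreal ((cmod (g x))\<^sup>2) \<partial>lborel) = (\<integral>\<^sup>+x. ennreal ((cmod (g x))\<^sup>2) \<partial>distr lborel borel (\<lambda>x. - x))"
    by simp
  also have "\<dots> = (\<integral>\<^sup>+x. ennreal ((cmod (g (- x)))\<^sup>2) \<partial>lborel)"
    by (rule nn_integral_distr) measurable
  finally show ?thesis by (simp add: L2_norm_def nn_integral_completion)
qed

text \<open>The reflected transform of \<open>G\<close> is the inverse transform of \<open>G\<close>, but it need not be integrable.
  Its Gaussian cut-offs \<open>h k\<close> are, and their Fourier integrals are the Gaussian means of \<open>G\<close>
  by \<open>gauss_summed_inversion\<close>.\<close>

lemma has_fourier_inverse_borel:
  fixes G :: "real ^ 'n \<Rightarrow> complex"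
  assumes G: "integrable lborel G" and G2: "G \<in> L2"
  shows "has_fourier (\<lambda>x. fourier_integral G (- x)) G"
proof -
  have Gb [measurable]: "G \<in> borel_measurable borel" using borel_measurable_integrable[OF G] by simp
  define s where "s k = 1 / (real k + 1)" for k :: nat
  have s_pos: "s k > 0" for k by (simp add: s_def)
  have s_lim: "s \<longlonglongrightarrow> 0"
    unfolding s_def by (rule LIMSEQ_inverse_real_of_nat[unfolded inverse_eq_divide, simplified add.commute[of 1] of_nat_Suc])
  let ?g = "\<lambda>x. fourier_integral G (- x)"
  have gb: "?g \<in> borel_measurable borel" by measurable
  have gL2: "?g \<in> L2"
    using gb G2 L2_norm_reflect[of "fourier_integral G"] L2_norm_fourier_integral_borel[OF G G2]
    by (simp add: L2_def measurable_completion)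
  define h where "h k x = complex_of_real (exp (- (norm (s k *\<^sub>R x))\<^sup>2 / 2)) * ?g x" for k x
  obtain B where B: "B \<ge> 0" "\<And>\<xi>. cmod (fourier_integral G \<xi>) \<le> B"
    using fourier_integral_bounded[OF G] by blast
  have wm: "(\<lambda>x::real^'n. complex_of_real (exp (- (norm (s k *\<^sub>R x))\<^sup>2 / 2))) \<in> borel_measurable lebesgue" for k
    by (rule measurable_completion) measurable
  have hb [measurable]: "h k \<in> borel_measurable borel" for k unfolding h_def by measurable
  have c: "(2 * pi) powr (real CARD('n) / 2) * gauss x = exp (- (norm x)\<^sup>2 / 2)" for x :: "real^'n"
    by (simp add: gauss_def powr_minus)
  have hi: "integrable lborel (h k)" for k
  proof -
    have "integrable lborel (\<lambda>x::real^'n. gauss (s k *\<^sub>R x))"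
      using lborel_integrable_affine[OF integrable_gauss, of "s k" 0] s_pos[of k] by simp
    then have "integrable lborel (\<lambda>x::real^'n. ((2 * pi) powr (real CARD('n) / 2) * gauss (s k *\<^sub>R x)) * B)" by simp
    then have "integrable lborel (\<lambda>x::real^'n. exp (- (norm (s k *\<^sub>R x))\<^sup>2 / 2) * B)" by (simp only: c)
    then show ?thesis
      by (rule Bochner_Integration.integrable_bound) (use B in \<open>auto simp: h_def norm_mult abs_mult intro!: mult_left_mono\<close>)
  qed
  have h12: "h k \<in> L1 \<inter> L2" for k
    using hi[of k] L2_mult_bounded[OF gL2 wm, of k 1] hb[of k] by (auto simp: L1_def h_def[abs_def] integrable_completion)
  have "(\<lambda>k. L2_norm (\<lambda>x. h k x - ?g x)) \<longlonglongrightarrow> 0"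
    unfolding h_def
  proof (rule L2_norm_tendsto_0_dominated[OF gL2 wm])
    fix x :: "real ^ 'n"
    have "(\<lambda>k. complex_of_real (exp (- (norm (s k *\<^sub>R x))\<^sup>2 / 2))) \<longlonglongrightarrow> complex_of_real (exp (- (norm (0 *\<^sub>R x))\<^sup>2 / 2))"
      by (intro tendsto_intros s_lim) simp
    then show "(\<lambda>k. complex_of_real (exp (- (norm (s k *\<^sub>R x))\<^sup>2 / 2))) \<longlonglongrightarrow> 1" by simp
  qed simp
  moreover have "fourier_integral (h k) = gauss_mean (s k) G" for k
  proof
    fix \<xi>
    let ?f = "\<lambda>x. exp (\<i> * complex_of_real (x \<bullet> \<xi>)) * fourier_integral G x * complex_of_real (gauss (s k *\<^sub>R x))"
    have "gauss_mean (s k) G \<xi> = (\<integral>x. ?f x \<partial>lborel)"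
      by (rule gauss_summed_inversion[OF G s_pos, symmetric])
    \<comment> \<open>Reflect, to pass from the inverse transform of the transform to the transform of \<open>h k\<close>.\<close>
    also have "\<dots> = \<bar>- 1\<bar> ^ DIM(real^'n) *\<^sub>R (\<integral>x. ?f (0 + (- 1) *\<^sub>R x) \<partial>lborel)"
      by (rule lborel_integral_affine) auto
    also have "\<dots> = (\<integral>x. complex_of_real ((2 * pi) powr (- real CARD('n) / 2)) * (exp (- \<i> * complex_of_real (\<xi> \<bullet> x)) * h k x) \<partial>lborel)"
      by (simp add: h_def gauss_def inner_commute mult_ac)
    also have "\<dots> = fourier_integral (h k) \<xi>"
      unfolding fourier_integral_borel[OF hb] by simp
    finally show "fourier_integral (h k) \<xi> = gauss_mean (s k) G \<xi>" ..
  qed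
  moreover have "(\<lambda>k. L2_norm (\<lambda>\<xi>. gauss_mean (s k) G \<xi> - G \<xi>)) \<longlonglongrightarrow> 0"
    using s_pos by (intro gauss_mean_tendsto_L2[OF G G2 _ s_lim]) (metis less_irrefl)
  ultimately show ?thesis
    unfolding has_fourier_def using gL2 G2 h12 by (intro conjI exI[of _ h]) auto
qed

text \<open>The transforms of the truncations form a Cauchy sequence by the isometry, and the graph is
  closed. Surjectivity follows in the same way from the preimages of truncations.\<close>

theorem has_fourier_exists:
  fixes g :: "real ^ 'n \<Rightarrow> complex"
  assumes g: "g \<in> L2"
  shows "\<exists>G. has_fourier g G"
proof -
  have t: "has_fourier (truncate k g) (fourier_integral (truncate k g))" for k
    by (rule has_fourier_L1_L2[OF truncate_L1_L2[OF g]])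
  have "L2_norm (\<lambda>\<xi>. fourier_integral (truncate j g) \<xi> - fourier_integral (truncate k g) \<xi>)
     \<le> L2_norm (\<lambda>x. truncate j g x - g x) + L2_norm (\<lambda>x. truncate k g x - g x)" for j k
  proof -
    note [measurable] = L2_measurable[OF g] L2_measurable[OF has_fourierD(1)[OF t]]
    show ?thesis
      unfolding has_fourier_isometry[OF has_fourier_diff[OF t t]] L2_norm_minus_commute[of "truncate k g" g]
      by (rule L2_norm_triangle) measurable
  qed
  then obtain G where "G \<in> L2" "(\<lambda>k. L2_norm (\<lambda>\<xi>. fourier_integral (truncate k g) \<xi> - G \<xi>)) \<longlonglongrightarrow> 0"
    using L2_complete[of "\<lambda>k. fourier_integral (truncate k g)", OF has_fourierD(2)[OF t] truncate_tendsto[OF g]] by blast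
  then show ?thesis using has_fourier_closed[OF t g _ truncate_tendsto[OF g]] by blast
qed

theorem has_fourier_surj:
  fixes G :: "real ^ 'n \<Rightarrow> complex"
  assumes G: "G \<in> L2"
  shows "\<exists>g. has_fourier g G"
proof -
  have "\<exists>g. has_fourier g (truncate k G)" for k
  proof -
    obtain G' where G': "integrable lborel G'" "G' \<in> L2" "AE x in lebesgue. truncate k G x = G' x"
      using L1_L2_borel_representative[OF truncate_L1_L2[OF G]] by metis
    have "AE x in lebesgue. G' x = truncate k G x" using G'(3) by eventually_elim simp
    then show ?thesis
      using has_fourier_cong_AE[OF has_fourier_inverse_borel[OF G'(1,2)]] truncate_L1_L2[OF G] by blast
  qed
  then obtain g where g: "\<And>k. has_fourier (g k) (truncate k G)" by metis
  have "L2_norm (\<lambda>x. g j x - g k x)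
     \<le> L2_norm (\<lambda>x. truncate j G x - G x) + L2_norm (\<lambda>x. truncate k G x - G x)" for j k
  proof -
    note [measurable] = L2_measurable[OF G] L2_measurable[OF has_fourierD(2)[OF g]]
    show ?thesis
      unfolding has_fourier_isometry[OF has_fourier_diff[OF g g], symmetric] L2_norm_minus_commute[of "truncate k G" G]
      by (rule L2_norm_triangle) measurable
  qed
  then obtain h where "h \<in> L2" "(\<lambda>k. L2_norm (\<lambda>x. g k x - h x)) \<longlonglongrightarrow> 0"
    using L2_complete[of g, OF has_fourierD(1)[OF g] truncate_tendsto[OF G]] by blast
  then show ?thesis using has_fourier_closed[OF g _ G _ truncate_tendsto[OF G]] by blast
qed

lemma has_fourier_fourier: "g \<in> L2 \<Longrightarrow> has_fourier g (fourier g)"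
  unfolding fourier_def using has_fourier_exists by (rule someI_ex)

lemma has_fourier_inverse_fourier: "G \<in> L2 \<Longrightarrow> has_fourier (inverse_fourier G) G"
  unfolding inverse_fourier_def using has_fourier_surj by (rule someI_ex)

section \<open>Estimates for the symbol and the filter\<close>

lemma Re_symbol_z: "Re (symbol_z \<alpha> \<beta> \<nu> \<xi>) = \<alpha>\<^sup>2 * (norm \<xi>)\<^sup>2 + \<nu>"
  by (simp add: symbol_z_def)

text \<open>With \<open>\<nu> > 0\<close> the left-hand side is positive: the denominator of \<open>\<Lambda>\<close> never vanishes, and its
  distance from 0 is uniform in \<open>\<xi>\<close>.\<close>

lemma norm_one_minus_exp_symbol_z_ge:
  assumes "t > 0"
  shows "1 - exp (- \<nu> * t) \<le> cmod (1 - exp (- symbol_z \<alpha> \<beta> \<nu> \<xi> * complex_of_real t))"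
proof -
  have "cmod (exp (- symbol_z \<alpha> \<beta> \<nu> \<xi> * complex_of_real t)) = exp (- (\<alpha>\<^sup>2 * (norm \<xi>)\<^sup>2 + \<nu>) * t)"
    by (simp add: norm_exp_eq_Re Re_symbol_z algebra_simps)
  also have "\<dots> \<le> exp (- \<nu> * t)"
  proof -
    have "\<nu> * t \<le> (\<alpha>\<^sup>2 * (norm \<xi>)\<^sup>2 + \<nu>) * t" using assms by (intro mult_right_mono) auto
    then show ?thesis by (simp only: exp_le_cancel_iff mult_minus_left neg_le_iff_le)
  qed
  finally show ?thesis
    using norm_triangle_ineq2[of 1 "exp (- symbol_z \<alpha> \<beta> \<nu> \<xi> * complex_of_real t)"]
    unfolding norm_one by linarith
qed

lemma norm_symbol_Lambda_le:
  assumes \<nu>: "\<nu> > 0" and t: "t > 0"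
  shows "cmod (symbol_Lambda \<alpha> \<beta> \<nu> t \<xi>) \<le> (\<alpha>\<^sup>2 + norm \<beta> + \<nu>) / (1 - exp (- \<nu> * t)) * (1 + (norm \<xi>)\<^sup>2)"
proof -
  have d: "0 < 1 - exp (- \<nu> * t)" using \<nu> t by simp
  have "2 * norm \<xi> \<le> 1 + (norm \<xi>)\<^sup>2"
    using zero_le_power2[of "norm \<xi> - 1"] by (simp add: power2_eq_square algebra_simps)
  then have r: "norm \<xi> \<le> 1 + (norm \<xi>)\<^sup>2"
    using norm_ge_zero[of \<xi>] by linarith
  have "cmod (symbol_z \<alpha> \<beta> \<nu> \<xi>) \<le> \<alpha>\<^sup>2 * (norm \<xi>)\<^sup>2 + \<bar>\<beta> \<bullet> \<xi>\<bar> + \<nu>"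
    unfolding symbol_z_def using \<nu>
    by (intro norm_triangle_le order_trans[OF norm_triangle_ineq] add_mono) (auto simp: norm_mult norm_power)
  also have "\<dots> \<le> \<alpha>\<^sup>2 * (1 + (norm \<xi>)\<^sup>2) + norm \<beta> * (1 + (norm \<xi>)\<^sup>2) + \<nu> * (1 + (norm \<xi>)\<^sup>2)"
    using \<nu> r order_trans[OF Cauchy_Schwarz_ineq2[of \<beta> \<xi>] mult_left_mono[OF r norm_ge_zero[of \<beta>]]]
    by (intro add_mono) (auto simp: algebra_simps)
  finally have z: "cmod (symbol_z \<alpha> \<beta> \<nu> \<xi>) \<le> (\<alpha>\<^sup>2 + norm \<beta> + \<nu>) * (1 + (norm \<xi>)\<^sup>2)"
    by (simp add: algebra_simps)
  have "cmod (symbol_Lambda \<alpha> \<beta> \<nu> t \<xi>) \<le> ((\<alpha>\<^sup>2 + norm \<beta> + \<nu>) * (1 + (norm \<xi>)\<^sup>2)) / (1 - exp (- \<nu> * t))"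
    unfolding symbol_Lambda_def norm_divide
    by (rule frac_le[OF order_trans[OF norm_ge_zero z] z d norm_one_minus_exp_symbol_z_ge[OF t]])
  then show ?thesis by simp
qed

lemma symbol_Lambda_measurable: "symbol_Lambda \<alpha> \<beta> \<nu> t \<in> borel_measurable borel"
  unfolding symbol_Lambda_def[abs_def] symbol_z_def[abs_def] by measurable

text \<open>The filter error saturates: for \<open>p \<le> 2\<close> it picks up the full smoothness through
  \<open>x / (1 + x) \<le> x powr (p/2)\<close> with \<open>x = q r\<close>, while for \<open>p > 2\<close> the best possible order in
  \<open>q\<close> is 1. This is where the maximum in the rate comes from.\<close>

lemma filter_bias_le:
  fixes q r p :: real
  assumes q: "q > 0" and r: "r \<ge> 0" and p: "p > 0"
  shows "q * r / (1 + q * r) \<le> max q (q powr (p / 2)) * (1 + r) powr (p / 2)"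
proof -
  define x where "x = q * r"
  have x: "0 \<le> x" using q r by (simp add: x_def)
  have x1: "x / (1 + x) \<le> x" using x by (simp add: field_simps)
  show ?thesis
  proof (cases "p \<le> 2")
    case True
    have "x / (1 + x) \<le> x powr (p / 2)"
    proof (cases "x \<le> 1")
      case True
      note x1
      also have "x \<le> x powr (p / 2)"
      proof (cases "x = 0")
        case False
        then have "x powr 1 \<le> x powr (p / 2)"
          using x True \<open>p \<le> 2\<close> by (intro powr_mono') auto
        then show ?thesis using x False by simp
      qed simp
      finally show ?thesis .
    next
      case False
      have "x / (1 + x) \<le> 1" using x by simp
      also have "1 \<le> x powr (p / 2)" using False p by (intro ge_one_powr_ge_zero) auto
      finally show ?thesis .
    qed
    also have "\<dots> = q powr (p / 2) * r powr (p / 2)" unfolding x_def using q r by (simp add: powr_mult)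
    also have "\<dots> \<le> max q (q powr (p / 2)) * (1 + r) powr (p / 2)"
      using r p q by (intro mult_mono powr_mono2) auto
    finally show ?thesis unfolding x_def .
  next
    case False
    have "q * r / (1 + q * r) \<le> q * r" using x1 by (simp only: x_def)
    also have "\<dots> \<le> q * (1 + r) powr 1" using q r by simp
    also have "\<dots> \<le> max q (q powr (p / 2)) * (1 + r) powr (p / 2)"
      using q r False by (intro mult_mono powr_mono) auto
    finally show ?thesis .
  qed
qed

lemma sobolev_norm_eq_L2_norm:
  fixes g :: "real ^ 'n \<Rightarrow> complex"
  shows "sobolev_norm p g = L2_norm (\<lambda>\<xi>. complex_of_real ((1 + (norm \<xi>)\<^sup>2) powr (p / 2)) * fourier g \<xi>)"
proof -
  have "(cmod (fourier g \<xi>))\<^sup>2 * (1 + (norm \<xi>)\<^sup>2) powr p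
      = (cmod (complex_of_real ((1 + (norm \<xi>)\<^sup>2) powr (p / 2)) * fourier g \<xi>))\<^sup>2" for \<xi> :: "real ^ 'n"
  proof -
    have "(1 + (norm \<xi>)\<^sup>2) powr p = ((1 + (norm \<xi>)\<^sup>2) powr (p / 2))\<^sup>2"
      by (simp add: power2_eq_square powr_add[symmetric])
    then show ?thesis
      by (simp only: norm_mult norm_of_real power_mult_distrib power2_abs mult.commute)
  qed
  then show ?thesis by (simp only: sobolev_norm_def L2_norm_def)
qed

section \<open>The evolution equation in frequency space\<close>

text \<open>Multiplied by the integrating factor \<open>exp (z t)\<close>, the function \<open>z U - F\<close> is constant. Multiplying by \<open>z\<close> avoids a
  case distinction at \<open>z = 0\<close>. The equation is only assumed for \<open>t > 0\<close>, so continuity at 0 is what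
  ties the solution to its initial value.\<close>

lemma linear_ode_solution:
  fixes U :: "real \<Rightarrow> complex"
  assumes cont: "continuous_on {0..} U" and U0: "U 0 = 0"
    and deriv: "\<And>t. 0 < t \<Longrightarrow> (U has_vector_derivative - z * U t + F) (at t)"
    and T: "0 \<le> T"
  shows "z * U T = (1 - exp (- z * complex_of_real T)) * F"
proof -
  define W where "W t = exp (z * complex_of_real t) * (z * U t - F)" for t :: real
  have "W T = W 0"
  \<comment> \<open>The exceptional set is the end point 0, where no derivative is given.\<close>
  proof (rule has_derivative_zero_unique_strong_convex[where S = "{0..T}" and K = "{0}" and c = 0])
    show "continuous_on {0..T} W"
      unfolding W_def by (intro continuous_intros continuous_on_subset[OF cont]) auto
    fix t assume "t \<in> {0..T} - {0}"
    then have t: "0 < t" by auto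
    have e: "((\<lambda>t. exp (z * complex_of_real t)) has_vector_derivative z * exp (z * complex_of_real t)) (at t)"
      by (auto intro!: derivative_eq_intros has_vector_derivative_real_field simp: mult.commute)
    have u: "((\<lambda>t. z * U t - F) has_vector_derivative z * (- z * U t + F)) (at t)"
      using has_vector_derivative_diff[OF has_vector_derivative_mult_right[OF deriv[OF t], of z] has_vector_derivative_const[of F]]
      by simp
    have "(W has_vector_derivative 0) (at t)"
      unfolding W_def by (rule has_vector_derivative_eq_rhs[OF has_vector_derivative_mult[OF e u]]) (simp add: algebra_simps)
    then show "(W has_derivative (\<lambda>h. 0)) (at t within {0..T})"
      by (auto simp: has_vector_derivative_def intro: has_derivative_at_withinI)
  qed (use T in auto)
  then have "exp (z * complex_of_real T) * (z * U T - F) = - F" by (simp add: W_def U0)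
  then have "exp (- (z * complex_of_real T)) * (exp (z * complex_of_real T) * (z * U T - F)) = - (exp (- (z * complex_of_real T)) * F)" by simp
  then have "z * U T - F = - (exp (- (z * complex_of_real T)) * F)"
    by (simp add: mult.assoc[symmetric] exp_add[symmetric])
  then show ?thesis by (simp add: algebra_simps)
qed

lemma AE_symbol_Lambda_data:
  fixes f :: "real ^ 'n \<Rightarrow> complex"
  assumes \<nu>: "\<nu> > 0" and t: "t > 0" and sol: "solves_evolution \<alpha> \<beta> \<nu> f u"
  shows "AE \<xi> in lebesgue. symbol_Lambda \<alpha> \<beta> \<nu> t \<xi> * fourier (u t) \<xi> = fourier f \<xi>"
proof -
  obtain U where U: "\<forall>t\<ge>0. AE \<xi> in lebesgue. U \<xi> t = fourier (u t) \<xi>"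
    "AE \<xi> in lebesgue. continuous_on {0..} (U \<xi>) \<and> U \<xi> 0 = 0 \<and>
           (\<forall>t>0. (U \<xi> has_vector_derivative (- symbol_z \<alpha> \<beta> \<nu> \<xi> * U \<xi> t + fourier f \<xi>)) (at t))"
    using sol unfolding solves_evolution_def by blast
  have "AE \<xi> in lebesgue. U \<xi> t = fourier (u t) \<xi>" using U(1) t by simp
  then show ?thesis
    using U(2)
  proof eventually_elim
    case (elim \<xi>)
    let ?z = "symbol_z \<alpha> \<beta> \<nu> \<xi>"
    have "?z * U \<xi> t = (1 - exp (- ?z * complex_of_real t)) * fourier f \<xi>"
      using elim(2) t by (intro linear_ode_solution) auto
    moreover have "1 - exp (- ?z * complex_of_real t) \<noteq> 0"
    proof -
      have "0 < 1 - exp (- \<nu> * t)" using \<nu> t by simp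
      then have "0 < cmod (1 - exp (- ?z * complex_of_real t))"
        using norm_one_minus_exp_symbol_z_ge[OF t, of \<nu> \<alpha> \<beta> \<xi>] by linarith
      then show ?thesis by (simp only: zero_less_norm_iff not_False_eq_True)
    qed
    ultimately show ?case
      using elim(1) by (simp add: symbol_Lambda_def field_simps)
  qed
qed

section \<open>The error bound\<close>

theorem theorem3:
  fixes \<alpha> \<nu> t\<^sub>0 \<delta>\<^sub>M p :: real
    and \<beta> :: "real ^ 'n"
    and f :: "real ^ 'n \<Rightarrow> complex"
    and u :: "real \<Rightarrow> real ^ 'n \<Rightarrow> complex"
  assumes "\<alpha>\<^sup>2 > 0" and "\<nu> > 0" and "t\<^sub>0 > 0" and "\<delta>\<^sub>M > 0" and "p > 0"
    and "f \<in> L2" and "sobolev_norm p f < \<infinity>"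
    and "\<forall>t\<ge>0. u t \<in> L2" and "solves_evolution \<alpha> \<beta> \<nu> f u"
  shows "\<exists>K\<ge>0. \<forall>\<delta> y\<^sub>\<delta> \<mu>.
    0 < \<delta> \<and> \<delta> \<le> \<delta>\<^sub>M \<and>
    y\<^sub>\<delta> \<in> L2 \<and> L2_norm (\<lambda>x. u t\<^sub>0 x - y\<^sub>\<delta> x) \<le> ennreal \<delta> \<and>
    \<mu> > 0 \<and> \<mu>\<^sup>2 = \<delta> powr (2 / (p + 2)) \<longrightarrow>
    L2_norm (\<lambda>x. f x - regularized_solution \<alpha> \<beta> \<nu> t\<^sub>0 \<mu> y\<^sub>\<delta> x)
      \<le> ennreal (K * max (\<delta> powr (2 / (p + 2))) (\<delta> powr (p / (p + 2))))"
proof -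
  have uL2: "u t\<^sub>0 \<in> L2" using assms by simp
  define S where "S = enn2real (sobolev_norm p f)"
  have S: "sobolev_norm p f = ennreal S" "S \<ge> 0"
    using assms(7) by (auto simp: S_def)
  \<comment> \<open>\<open>A (1 + r)\<close> bounds \<open>\<Lambda>\<close>, and \<open>M\<close> bounds \<open>\<mu>\<^sup>2\<close> over all admissible noise levels.\<close>
  define A where "A = (\<alpha>\<^sup>2 + norm \<beta> + \<nu>) / (1 - exp (- \<nu> * t\<^sub>0))"
  have A: "A \<ge> 0" unfolding A_def using assms(2,3) by (intro divide_nonneg_nonneg) auto
  define M where "M = \<delta>\<^sub>M powr (2 / (p + 2))"
  have M: "M \<ge> 0" by (simp add: M_def)
  show ?thesis
  proof (intro exI[of _ "S + A * (1 + M)"] conjI allI impI)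
    show "S + A * (1 + M) \<ge> 0" using S A M by simp
    fix \<delta> y\<^sub>\<delta> \<mu>
    assume *: "0 < \<delta> \<and> \<delta> \<le> \<delta>\<^sub>M \<and> y\<^sub>\<delta> \<in> L2 \<and> L2_norm (\<lambda>x. u t\<^sub>0 x - y\<^sub>\<delta> x) \<le> ennreal \<delta> \<and>
      \<mu> > 0 \<and> \<mu>\<^sup>2 = \<delta> powr (2 / (p + 2))"
    define q where "q = \<mu>\<^sup>2"
    have q: "q = \<delta> powr (2 / (p + 2))" "q > 0" using * by (auto simp: q_def)
    have qM: "q \<le> M" unfolding q M_def using * assms(5) by (intro powr_mono2) auto
    have qp: "q powr (p / 2) = \<delta> powr (p / (p + 2))"
    proof -
      have "2 / (p + 2) * (p / 2) = p / (p + 2)" using assms(5) by (simp add: divide_simps algebra_simps)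
      then show ?thesis by (simp only: q(1) powr_powr)
    qed
    have \<delta>q: "\<delta> / q = \<delta> powr (p / (p + 2))"
    proof -
      have "\<delta> / q = \<delta> powr (1 - 2 / (p + 2))" using * by (simp add: q powr_diff)
      also have "1 - 2 / (p + 2) = p / (p + 2)" using assms(5) by (simp add: field_simps)
      finally show ?thesis .
    qed
    define X where "X = max (\<delta> powr (2 / (p + 2))) (\<delta> powr (p / (p + 2)))"
    have X: "X \<ge> 0" "\<delta> / q \<le> X" unfolding X_def \<delta>q by (simp_all add: le_max_iff_disj)
    have X_q: "X = max q (q powr (p / 2))"
      unfolding X_def qp[symmetric] q(1)[symmetric] ..
    define m where "m \<xi> = symbol_Lambda \<alpha> \<beta> \<nu> t\<^sub>0 \<xi> / complex_of_real (1 + \<mu>\<^sup>2 * (norm \<xi>)\<^sup>2)" for \<xi>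
    have m_measurable [measurable]: "m \<in> borel_measurable lebesgue"
    proof -
      note [measurable] = symbol_Lambda_measurable
      have "m \<in> borel_measurable borel" unfolding m_def[abs_def] by measurable
      then show ?thesis by (intro measurable_completion) simp
    qed
    have m_le: "cmod (m \<xi>) \<le> A * ((1 + M) / q)" for \<xi>
    proof -
      let ?r = "(norm \<xi>)\<^sup>2"
      have "cmod (m \<xi>) = cmod (symbol_Lambda \<alpha> \<beta> \<nu> t\<^sub>0 \<xi>) / (1 + q * ?r)"
        unfolding m_def norm_divide norm_of_real q_def by simp
      also have "\<dots> \<le> A * (1 + ?r) / (1 + q * ?r)"
        unfolding A_def using norm_symbol_Lambda_le[OF assms(2,3)] q by (intro divide_right_mono) auto
      also have "\<dots> = A * ((1 + ?r) / (1 + q * ?r))" by simp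
      also have "\<dots> \<le> A * ((1 + M) / q)"
      proof (rule mult_left_mono[OF _ A])
        have "q + q * ?r \<le> M + 1 + (q * ?r + M * (q * ?r))"
          using qM M less_imp_le[OF q(2)] by (intro add_mono) simp_all
        then show "(1 + ?r) / (1 + q * ?r) \<le> (1 + M) / q"
          using q by (simp add: divide_le_eq pos_le_divide_eq add_pos_nonneg) (simp add: algebra_simps)
      qed
      finally show ?thesis .
    qed
    note F = has_fourier_fourier[OF assms(6)] and Y = has_fourier_fourier[OF uL2]
    have yL2: "y\<^sub>\<delta> \<in> L2" using * by blast
    note Y\<delta> = has_fourier_fourier[OF yL2]
    note [measurable] = L2_measurable[OF has_fourierD(2)[OF F]] L2_measurable[OF has_fourierD(2)[OF Y]]
      L2_measurable[OF has_fourierD(2)[OF Y\<delta>]]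
    have "(\<lambda>\<xi>. m \<xi> * fourier y\<^sub>\<delta> \<xi>) \<in> L2"
      by (rule L2_mult_bounded[OF has_fourierD(2)[OF Y\<delta>] m_measurable m_le]) (use A M q in auto)
    then have "has_fourier (regularized_solution \<alpha> \<beta> \<nu> t\<^sub>0 \<mu> y\<^sub>\<delta>) (\<lambda>\<xi>. m \<xi> * fourier y\<^sub>\<delta> \<xi>)"
      unfolding regularized_solution_def m_def by (rule has_fourier_inverse_fourier)
    from has_fourier_isometry[OF has_fourier_diff[OF F this]]
    have "L2_norm (\<lambda>x. f x - regularized_solution \<alpha> \<beta> \<nu> t\<^sub>0 \<mu> y\<^sub>\<delta> x) = L2_norm (\<lambda>\<xi>. fourier f \<xi> - m \<xi> * fourier y\<^sub>\<delta> \<xi>)"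
      by simp
    \<comment> \<open>Bias plus amplified noise.\<close>
    also have "\<dots> \<le> L2_norm (\<lambda>\<xi>. fourier f \<xi> - m \<xi> * fourier (u t\<^sub>0) \<xi>) + L2_norm (\<lambda>\<xi>. m \<xi> * fourier (u t\<^sub>0) \<xi> - m \<xi> * fourier y\<^sub>\<delta> \<xi>)"
      by (rule L2_norm_triangle) measurable
    also have "L2_norm (\<lambda>\<xi>. fourier f \<xi> - m \<xi> * fourier (u t\<^sub>0) \<xi>) \<le> ennreal X * ennreal S"
      unfolding S(1)[symmetric] sobolev_norm_eq_L2_norm
    proof (rule L2_norm_mult_le[OF _ X(1)])
      show "(\<lambda>\<xi>. complex_of_real ((1 + (norm \<xi>)\<^sup>2) powr (p / 2)) * fourier f \<xi>) \<in> borel_measurable lebesgue"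
        by (intro borel_measurable_times measurable_completion[of "\<lambda>\<xi>. complex_of_real ((1 + (norm \<xi>)\<^sup>2) powr (p / 2))"]) measurable
      show "AE \<xi> in lebesgue. cmod (fourier f \<xi> - m \<xi> * fourier (u t\<^sub>0) \<xi>)
          \<le> X * cmod (complex_of_real ((1 + (norm \<xi>)\<^sup>2) powr (p / 2)) * fourier f \<xi>)"
        using AE_symbol_Lambda_data[OF assms(2,3,9)]
      proof eventually_elim
        case (elim \<xi>)
        let ?r = "(norm \<xi>)\<^sup>2"
        have pos: "1 + q * ?r > 0" using q by (intro add_pos_nonneg) auto
        have "m \<xi> * fourier (u t\<^sub>0) \<xi> = fourier f \<xi> / complex_of_real (1 + q * ?r)"
          unfolding m_def elim[symmetric] q_def by simp
        then have "fourier f \<xi> - m \<xi> * fourier (u t\<^sub>0) \<xi> = complex_of_real (1 - 1 / (1 + q * ?r)) * fourier f \<xi>"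
          by (simp add: left_diff_distrib)
        also have "1 - 1 / (1 + q * ?r) = q * ?r / (1 + q * ?r)" using pos by (simp add: field_simps)
        finally have "cmod (fourier f \<xi> - m \<xi> * fourier (u t\<^sub>0) \<xi>) = q * ?r / (1 + q * ?r) * cmod (fourier f \<xi>)"
          using q pos by (simp only: norm_mult norm_of_real) simp
        also have "\<dots> \<le> (X * (1 + ?r) powr (p / 2)) * cmod (fourier f \<xi>)"
          unfolding X_q using q assms(5) by (intro mult_right_mono filter_bias_le) auto
        finally show ?case by (simp add: norm_mult mult.assoc)
      qed
    qed
    also have "L2_norm (\<lambda>\<xi>. m \<xi> * fourier (u t\<^sub>0) \<xi> - m \<xi> * fourier y\<^sub>\<delta> \<xi>) \<le> ennreal (A * ((1 + M) / q)) * ennreal \<delta>"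
    proof -
      have "L2_norm (\<lambda>\<xi>. m \<xi> * fourier (u t\<^sub>0) \<xi> - m \<xi> * fourier y\<^sub>\<delta> \<xi>)
          \<le> ennreal (A * ((1 + M) / q)) * L2_norm (\<lambda>\<xi>. fourier (u t\<^sub>0) \<xi> - fourier y\<^sub>\<delta> \<xi>)"
      proof (rule L2_norm_mult_le)
        show "A * ((1 + M) / q) \<ge> 0" using A M q(2) by (intro mult_nonneg_nonneg divide_nonneg_pos) auto
        show "AE \<xi> in lebesgue. cmod (m \<xi> * fourier (u t\<^sub>0) \<xi> - m \<xi> * fourier y\<^sub>\<delta> \<xi>)
            \<le> A * ((1 + M) / q) * cmod (fourier (u t\<^sub>0) \<xi> - fourier y\<^sub>\<delta> \<xi>)"
          unfolding right_diff_distrib[symmetric] norm_mult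
          by (intro AE_I2 mult_right_mono m_le norm_ge_zero)
      qed measurable
      also have "L2_norm (\<lambda>\<xi>. fourier (u t\<^sub>0) \<xi> - fourier y\<^sub>\<delta> \<xi>) \<le> ennreal \<delta>"
        using has_fourier_isometry[OF has_fourier_diff[OF Y Y\<delta>]] * by simp
      finally show ?thesis by (simp add: mult_left_mono)
    qed
    also have "ennreal X * ennreal S + ennreal (A * ((1 + M) / q)) * ennreal \<delta> = ennreal (S * X + A * (1 + M) * (\<delta> / q))"
      using X S A M q * by (simp add: ennreal_mult[symmetric] ennreal_plus[symmetric] mult_ac del: ennreal_plus)
    also have "\<dots> \<le> ennreal ((S + A * (1 + M)) * X)"
      unfolding distrib_right using A M by (intro ennreal_leI add_left_mono mult_left_mono X(2)) auto
    finally show "L2_norm (\<lambda>x. f x - regularized_solution \<alpha> \<beta> \<nu> t\<^sub>0 \<mu> y\<^sub>\<delta> x)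
      \<le> ennreal ((S + A * (1 + M)) * max (\<delta> powr (2 / (p + 2))) (\<delta> powr (p / (p + 2))))"
      unfolding X_def by (simp add: add_mono)
  qed
qed

end
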